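(* Let $d\ge1$, $R\ge 1$, let $D\subset\mathbb Z^d$ be an $R$-Delone set, and let $H_\omega=-\Delta+V_\omega$ be the associated Anderson model with missing sites with single-site distribution $\mu$. There exists an energy $E_W>0$ such that for any compact interval $\mathcal I\subset I=[0,E_W]$ there exists a finite constant $Q_W=Q_W(\mathcal I,\mu,R)$ such that for every $E\in\mathcal I$, $$\mathbb P\left(\operatorname{dist}(\sigma(H_{\omega,x,L}),E)\le\eta\right)\le Q_W\,\eta\,L^d$$ for all $\eta\in(0,1]$ and all $L\in\mathbb N$, $L\geq 1$, uniformly with respect to $x\in\mathbb Z^d$ (i.e. for all $x\in\mathbb Z^d$ with the same $Q_W$).
   Context: **Delone sets.** For a constant $R\ge 1$, a subset $D\subset\mathbb Z^d$ is an $R$-Delone set in $\mathbb Z^d$ if every closed cube in $\mathbb Z^d$ of side length $R$ in the max-norm, i.e. every set $(a+[0,R]^d)\cap\mathbb Z^d$ with $a\in\mathbb Z^d$, contains at least one point of $D$. No periodicity is assumed. **The model.** $(-\Delta u)(n)=-\sum_{|m-n|_1=1}(u(m)-u(n))$ on $\ell^2(\mathbb Z^d)$, where $|n|_1=\sum_i|n_i|$. The random potential is $V_\omega(n)=\omega(n)$ if $n\in D$ and $V_\omega(n)=0$ otherwise, acting as a multiplication operator, where $(\omega(n))_{n\in D}$ are i.i.d. real random variables with common distribution $\mu$, $\operatorname{supp}\mu\subset[0,M]$ for some $M>0$, on the product space $\Omega=[0,M]^D$ with probability $\mathbb P$. The distribution $\mu$ is regular, meaning absolutely continuous with bounded density (equivalently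 $\sup_{a\in\mathbb R}\mu([a,a+t])\le C_\mu t$ for all $t>0$ and some finite $C_\mu$). **Finite volume.** $\Lambda_L(x)=\{n\in\mathbb Z^d:|n-x|_\infty\le L\}$, and $H_{\omega,x,L}$ is the restriction $\chi_{\Lambda_L(x)}H_\omega\chi_{\Lambda_L(x)}$ of $H_\omega$ to $\ell^2(\Lambda_L(x))$. The dimension $d$ is fixed throughout, and constants may depend on it. *)

theory Defs
  imports "HOL-Probability.Probability"
begin

definition norm1 :: "int ^ 'd \<Rightarrow> int" where
  "norm1 n = (\<Sum>i\<in>UNIV. \<bar>n $ i\<bar>)"

definition norm_max :: "int ^ 'd \<Rightarrow> int" where
  "norm_max n = Max (range (\<lambda>i. \<bar>n $ i\<bar>))"

definition lattice_cube :: "real \<Rightarrow> int ^ 'd \<Rightarrow> (int ^ 'd) set" where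
  "lattice_cube R a = {n. \<forall>i. real_of_int (n $ i) \<in> {real_of_int (a $ i) .. real_of_int (a $ i) + R}}"

definition delone :: "real \<Rightarrow> (int ^ 'd) set \<Rightarrow> bool" where
  "delone R D \<longleftrightarrow> (\<forall>a. lattice_cube R a \<inter> D \<noteq> {})"

text \<open>
  The space of square-summable functions on a set of lattice sites; a function on the sites
  of \<open>A\<close> is represented by its extension by zero to the whole lattice.
\<close>

definition ell2 :: "(int ^ 'd) set \<Rightarrow> (int ^ 'd \<Rightarrow> complex) set" where
  "ell2 A = {u. (\<forall>n. n \<notin> A \<longrightarrow> u n = 0) \<and> (\<lambda>n. (norm (u n))\<^sup>2) summable_on A}"

definition neg_laplacian :: "(int ^ 'd \<Rightarrow> complex) \<Rightarrow> int ^ 'd \<Rightarrow> complex" where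
  "neg_laplacian u n = - (\<Sum>m | norm1 (m - n) = 1. u m - u n)"

definition potential :: "(int ^ 'd) set \<Rightarrow> (int ^ 'd \<Rightarrow> real) \<Rightarrow> int ^ 'd \<Rightarrow> real" where
  "potential D \<omega> n = (if n \<in> D then \<omega> n else 0)"

definition hamiltonian ::
  "(int ^ 'd) set \<Rightarrow> (int ^ 'd \<Rightarrow> real) \<Rightarrow> (int ^ 'd \<Rightarrow> complex) \<Rightarrow> int ^ 'd \<Rightarrow> complex" where
  "hamiltonian D \<omega> u n = neg_laplacian u n + complex_of_real (potential D \<omega> n) * u n"

definition lattice_box :: "nat \<Rightarrow> int ^ 'd \<Rightarrow> (int ^ 'd) set" where
  "lattice_box L x = {n. norm_max (n - x) \<le> int L}"

definition cutoff :: "(int ^ 'd) set \<Rightarrow> (int ^ 'd \<Rightarrow> complex) \<Rightarrow> int ^ 'd \<Rightarrow> complex" where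
  "cutoff A u n = (if n \<in> A then u n else 0)"

definition box_hamiltonian ::
  "(int ^ 'd) set \<Rightarrow> (int ^ 'd \<Rightarrow> real) \<Rightarrow> int ^ 'd \<Rightarrow> nat
     \<Rightarrow> (int ^ 'd \<Rightarrow> complex) \<Rightarrow> int ^ 'd \<Rightarrow> complex" where
  "box_hamiltonian D \<omega> x L u = cutoff (lattice_box L x) (hamiltonian D \<omega> (cutoff (lattice_box L x) u))"

text \<open>
  The complement of the resolvent set of a bounded operator \<open>T\<close> on \<open>ell2 A\<close>. Boundedness of the
  inverse need not be required: it is automatic (trivially so for finite \<open>A\<close>).
\<close>

definition op_spectrum ::
  "(int ^ 'd) set \<Rightarrow> ((int ^ 'd \<Rightarrow> complex) \<Rightarrow> int ^ 'd \<Rightarrow> complex) \<Rightarrow> complex set" where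
  "op_spectrum A T = {z. \<not> bij_betw (\<lambda>u n. T u n - z * u n) (ell2 A) (ell2 A)}"

definition measure_support :: "real measure \<Rightarrow> real set" where
  "measure_support \<mu> = {t. \<forall>U. open U \<longrightarrow> t \<in> U \<longrightarrow> emeasure \<mu> U > 0}"

definition has_bounded_density :: "real measure \<Rightarrow> bool" where
  "has_bounded_density \<mu> \<longleftrightarrow>
     (\<exists>f C. f \<in> borel_measurable lborel \<and> (\<forall>t. 0 \<le> f t \<and> f t \<le> C) \<and>
            \<mu> = density lborel (\<lambda>t. ennreal (f t)))"

text \<open>
  The law of the i.i.d. couplings. The sample space is \<open>[0,M]\<close> to the power \<open>D\<close>, as functions that
  are \<open>undefined\<close> off \<open>D\<close>; restricting \<open>\<mu>\<close> to \<open>[0,M]\<close> loses no mass if its support lies there.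
\<close>

definition coupling_space ::
  "real \<Rightarrow> real measure \<Rightarrow> (int ^ 'd) set \<Rightarrow> (int ^ 'd \<Rightarrow> real) measure" where
  "coupling_space M \<mu> D = (\<Pi>\<^sub>M n\<in>D. restrict_space \<mu> {0..M})"

text \<open>The sum defining the Laplacian is a finite one, and so the library's sum is the genuine one.\<close>

lemma finite_neighbours: "finite {m :: int ^ 'd. norm1 (m - n) = 1}"
proof -
  have sub: "{m :: int ^ 'd. norm1 (m - n) = 1} \<subseteq>
      vec_lambda ` (UNIV \<rightarrow>\<^sub>E (\<Union>i. {n $ i - 1 .. n $ i + 1}))"
  proof
    fix m :: "int ^ 'd"
    assume "m \<in> {m. norm1 (m - n) = 1}"
    then have s: "(\<Sum>i\<in>UNIV. \<bar>(m - n) $ i\<bar>) = 1" by (simp add: norm1_def)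
    have le: "\<bar>m $ i - n $ i\<bar> \<le> 1" for i
      using member_le_sum[of i UNIV "\<lambda>i. \<bar>(m - n) $ i\<bar>"] s by simp
    have "m $ i \<in> {n $ i - 1 .. n $ i + 1}" for i
      using le[of i] by auto
    then have "vec_nth m \<in> UNIV \<rightarrow>\<^sub>E (\<Union>i. {n $ i - 1 .. n $ i + 1})"
      unfolding PiE_UNIV_domain by (intro Pi_I UN_I[OF UNIV_I])
    then have "vec_lambda (vec_nth m) \<in> vec_lambda ` (UNIV \<rightarrow>\<^sub>E (\<Union>i. {n $ i - 1 .. n $ i + 1}))"
      by (rule imageI)
    then show "m \<in> vec_lambda ` (UNIV \<rightarrow>\<^sub>E (\<Union>i. {n $ i - 1 .. n $ i + 1}))"
      by (simp only: vec_lambda_eta)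
  qed
  show ?thesis
    by (rule finite_subset[OF sub]) (intro finite_imageI finite_PiE finite_UN_I finite finite_atLeastAtMost_int)
qed

end

theory Submission
  imports Defs
begin

text \<open>
  Extend functions on the box \<open>\<Lambda>\<close> by zero. Since every site is within bounded distance of \<open>D\<close>, a discrete
  Poincare inequality \<open>\<parallel>u\<parallel>\<^sup>2 \<le> C (\<parallel>u|\<^bsub>D\<^esub>\<parallel>\<^sup>2 + 2 \<langle>u, -\<Delta>u\<rangle>)\<close> holds with \<open>C\<close> independent of the box. As the potential is
  nonnegative, a normalised approximate eigenvector at low energy therefore carries at least the mass
  \<open>1/(2C)\<close> on \<open>D\<close>.

  If \<open>E\<close> is within \<open>\<eta>\<close> of the spectrum, take a unit vector \<open>u\<close> with \<open>\<parallel>(H - E)u\<parallel> \<le> 2\<eta>\<close> and put \<open>z = E + i\<eta>\<close>,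
  \<open>g\<^sub>p = (H - z)\<^sup>-\<^sup>1 \<delta>\<^sub>p\<close>. Then \<open>|u(p)| \<le> \<parallel>(H - z)u\<parallel> \<parallel>g\<^sub>p\<parallel>\<close> and \<open>Im g\<^sub>p(p) = \<eta> \<parallel>g\<^sub>p\<parallel>\<^sup>2\<close>, so that the sum of \<open>Im g\<^sub>p(p)\<close> over
  \<open>p \<in> D \<inter> \<Lambda>\<close> is at least of order \<open>1/\<eta>\<close>. As a function of the single coupling \<open>v = \<omega>(p)\<close> the diagonal Green
  function is \<open>g/(1 + v g)\<close> with \<open>g\<close> independent of \<open>v\<close>; its imaginary part is a Cauchy density in \<open>v\<close> of
  total mass \<open>\<pi>\<close>, and integrating against a bounded density gives a bound uniform in everything else.
  No eigenvalue counting is involved, which is why the bound is linear in the volume.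
\<close>

section \<open>Operators given by a kernel on a finite set\<close>

text \<open>The value 0 is forced off \<open>A\<close>, so that outputs are again extensions by
  zero, the form in which \<open>ell2 A\<close> represents its elements.\<close>

definition kernel_op :: "'a set \<Rightarrow> ('a \<Rightarrow> 'a \<Rightarrow> complex) \<Rightarrow> ('a \<Rightarrow> complex) \<Rightarrow> 'a \<Rightarrow> complex" where
  "kernel_op A k u n = (if n \<in> A then \<Sum>m\<in>A. k n m * u m else 0)"

definition adjoint_kernel :: "('a \<Rightarrow> 'a \<Rightarrow> complex) \<Rightarrow> 'a \<Rightarrow> 'a \<Rightarrow> complex" where
  "adjoint_kernel k n m = cnj (k m n)"

definition inner_on :: "'a set \<Rightarrow> ('a \<Rightarrow> complex) \<Rightarrow> ('a \<Rightarrow> complex) \<Rightarrow> complex" where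
  "inner_on A u v = (\<Sum>n\<in>A. u n * cnj (v n))"

definition sqnorm :: "'a set \<Rightarrow> ('a \<Rightarrow> complex) \<Rightarrow> real" where
  "sqnorm A u = (\<Sum>n\<in>A. (cmod (u n))\<^sup>2)"

text \<open>Squared Hilbert-Schmidt norm: an upper bound for the squared operator norm that is
  explicit in the entries, hence measurable in parameters.\<close>

definition hs_sqnorm :: "'a set \<Rightarrow> ('a \<Rightarrow> 'a \<Rightarrow> complex) \<Rightarrow> real" where
  "hs_sqnorm A k = (\<Sum>n\<in>A. \<Sum>m\<in>A. (cmod (k n m))\<^sup>2)"

lemma sqnorm_nonneg [simp]: "0 \<le> sqnorm A u"
  by (simp add: sqnorm_def sum_nonneg)

lemma hs_sqnorm_nonneg [simp]: "0 \<le> hs_sqnorm A k"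
  by (simp add: hs_sqnorm_def sum_nonneg)

lemma hs_sqnorm_adjoint [simp]: "hs_sqnorm A (adjoint_kernel k) = hs_sqnorm A k"
  unfolding hs_sqnorm_def adjoint_kernel_def by (subst sum.swap) simp

lemma sqnorm_eq_0_iff: "finite A \<Longrightarrow> sqnorm A u = 0 \<longleftrightarrow> (\<forall>n\<in>A. u n = 0)"
  by (simp add: sqnorm_def sum_nonneg_eq_0_iff)

lemma sqnorm_cong: "(\<And>n. n \<in> A \<Longrightarrow> u n = v n) \<Longrightarrow> sqnorm A u = sqnorm A v"
  by (simp add: sqnorm_def)

lemma cmod_sq_le_sqnorm: "finite A \<Longrightarrow> n \<in> A \<Longrightarrow> (cmod (u n))\<^sup>2 \<le> sqnorm A u"
  unfolding sqnorm_def by (rule member_le_sum) auto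

lemma sqnorm_scale: "sqnorm A (\<lambda>n. c * u n) = (cmod c)\<^sup>2 * sqnorm A u"
  by (simp add: sqnorm_def norm_mult power_mult_distrib sum_distrib_left)

lemma inner_on_self: "inner_on A u u = complex_of_real (sqnorm A u)"
  unfolding inner_on_def sqnorm_def of_real_sum
  by (intro sum.cong refl) (simp add: complex_norm_square[symmetric])

lemma inner_on_commute: "inner_on A v u = cnj (inner_on A u v)"
  by (simp add: inner_on_def mult.commute)

lemma inner_on_add: "inner_on A (\<lambda>n. u n + v n) w = inner_on A u w + inner_on A v w"
  by (simp add: inner_on_def sum.distrib distrib_right)

lemma inner_on_scale: "inner_on A (\<lambda>n. c * u n) w = c * inner_on A u w"
  by (simp add: inner_on_def sum_distrib_left mult.assoc)

lemma inner_on_Cauchy_Schwarz: "(cmod (inner_on A u v))\<^sup>2 \<le> sqnorm A u * sqnorm A v"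
proof -
  have "cmod (inner_on A u v) \<le> (\<Sum>n\<in>A. \<bar>cmod (u n)\<bar> * \<bar>cmod (v n)\<bar>)"
    unfolding inner_on_def by (rule order_trans[OF norm_sum]) (simp add: norm_mult)
  also have "\<dots> \<le> L2_set (\<lambda>n. cmod (u n)) A * L2_set (\<lambda>n. cmod (v n)) A"
    by (rule L2_set_mult_ineq)
  finally have "(cmod (inner_on A u v))\<^sup>2 \<le> (L2_set (\<lambda>n. cmod (u n)) A * L2_set (\<lambda>n. cmod (v n)) A)\<^sup>2"
    by (simp add: power_mono)
  then show ?thesis
    by (simp add: power_mult_distrib L2_set_def sqnorm_def sum_nonneg)
qed

lemma inner_on_kernel_op:
  "inner_on A (kernel_op A k u) v = inner_on A u (kernel_op A (adjoint_kernel k) v)"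
proof -
  have "inner_on A (kernel_op A k u) v = (\<Sum>n\<in>A. \<Sum>m\<in>A. k n m * u m * cnj (v n))"
    by (simp add: inner_on_def kernel_op_def sum_distrib_right)
  also have "\<dots> = (\<Sum>m\<in>A. \<Sum>n\<in>A. k n m * u m * cnj (v n))"
    by (rule sum.swap)
  also have "\<dots> = inner_on A u (kernel_op A (adjoint_kernel k) v)"
    by (simp add: inner_on_def kernel_op_def adjoint_kernel_def sum_distrib_left mult.assoc mult.left_commute)
  finally show ?thesis .
qed

lemma kernel_op_add: "kernel_op A k (\<lambda>n. u n + v n) = (\<lambda>n. kernel_op A k u n + kernel_op A k v n)"
  by (rule ext) (simp add: kernel_op_def distrib_left sum.distrib)

lemma kernel_op_diff: "kernel_op A k (\<lambda>n. u n - v n) = (\<lambda>n. kernel_op A k u n - kernel_op A k v n)"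
  by (rule ext) (simp add: kernel_op_def right_diff_distrib sum_subtractf)

lemma kernel_op_scale: "kernel_op A k (\<lambda>n. c * u n) = (\<lambda>n. c * kernel_op A k u n)"
  by (rule ext) (simp add: kernel_op_def sum_distrib_left mult.left_commute)

lemma kernel_op_cong:
  "(\<And>n. n \<in> A \<Longrightarrow> u n = v n) \<Longrightarrow> kernel_op A k u = kernel_op A k v"
  by (rule ext) (simp add: kernel_op_def)

lemma sqnorm_kernel_op_le: "sqnorm A (kernel_op A k u) \<le> hs_sqnorm A k * sqnorm A u"
proof -
  have "(cmod (\<Sum>m\<in>A. k n m * u m))\<^sup>2 \<le> (\<Sum>m\<in>A. (cmod (k n m))\<^sup>2) * sqnorm A u" for n
    using inner_on_Cauchy_Schwarz[of A "k n" "\<lambda>m. cnj (u m)"]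
    by (simp add: inner_on_def sqnorm_def)
  then have "sqnorm A (kernel_op A k u) \<le> (\<Sum>n\<in>A. (\<Sum>m\<in>A. (cmod (k n m))\<^sup>2) * sqnorm A u)"
    unfolding sqnorm_def kernel_op_def by (intro sum_mono) (simp add: sqnorm_def)
  then show ?thesis
    by (simp add: hs_sqnorm_def sum_distrib_right)
qed

lemma sqnorm_add: "sqnorm A (\<lambda>n. u n + v n) = sqnorm A u + 2 * Re (inner_on A u v) + sqnorm A v"
proof -
  have *: "(cmod (a + b))\<^sup>2 = (cmod a)\<^sup>2 + 2 * Re (a * cnj b) + (cmod b)\<^sup>2" for a b :: complex
    by (simp only: cmod_power2) (simp add: power2_eq_square algebra_simps)
  show ?thesis
    by (simp add: sqnorm_def inner_on_def * sum.distrib sum_distrib_left)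
qed

lemma sqnorm_add_le: "sqnorm A (\<lambda>n. u n + v n) \<le> 2 * sqnorm A u + 2 * sqnorm A v"
proof -
  have "(cmod (a + b))\<^sup>2 \<le> 2 * (cmod a)\<^sup>2 + 2 * (cmod b)\<^sup>2" for a b :: complex
    using power_mono[OF norm_triangle_ineq[of a b] norm_ge_zero, of 2] sum_squares_bound[of "cmod a" "cmod b"]
    by (simp add: power2_sum)
  then show ?thesis
    by (auto simp: sqnorm_def sum_distrib_left sum.distrib[symmetric] intro!: sum_mono)
qed

text \<open>
  Richardson iteration for the normal equations \<open>T\<^sup>* T x = T\<^sup>* f\<close>. It yields solvability and, since every
  iterate is an explicit expression in the kernel, measurable dependence of the solution on parameters.
\<close>

definition landweber_step ::
  "'a set \<Rightarrow> ('a \<Rightarrow> 'a \<Rightarrow> complex) \<Rightarrow> ('a \<Rightarrow> complex) \<Rightarrow> ('a \<Rightarrow> complex) \<Rightarrow> 'a \<Rightarrow> complex" where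
  "landweber_step A k f x n = x n - complex_of_real (1 / (1 + hs_sqnorm A k)) *
     kernel_op A (adjoint_kernel k) (\<lambda>m. kernel_op A k x m - f m) n"

definition landweber :: "'a set \<Rightarrow> ('a \<Rightarrow> 'a \<Rightarrow> complex) \<Rightarrow> ('a \<Rightarrow> complex) \<Rightarrow> nat \<Rightarrow> 'a \<Rightarrow> complex" where
  "landweber A k f j = (landweber_step A k f ^^ j) (\<lambda>_. 0)"

text \<open>Expanding the square gives |u|^2 - 2t |Tu|^2 + t^2 |w|^2, where w is the adjoint of T
  applied to Tu. The step size makes t times the squared norm of the adjoint at most 1, so the last
  term gives back at most half of the gain. The 1 in the denominator covers the zero kernel.\<close>

lemma landweber_contraction:
  assumes c: "\<And>u. c * sqnorm A u \<le> sqnorm A (kernel_op A k u)"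
  defines "t \<equiv> 1 / (1 + hs_sqnorm A k)"
  shows "sqnorm A (\<lambda>n. u n - complex_of_real t * kernel_op A (adjoint_kernel k) (kernel_op A k u) n)
    \<le> (1 - t * c) * sqnorm A u"
proof -
  let ?w = "kernel_op A (adjoint_kernel k) (kernel_op A k u)"
  let ?h = "hs_sqnorm A k"
  have t0: "t > 0" and th: "t * ?h \<le> 1"
    by (auto simp: t_def divide_simps add_pos_nonneg)
  have ip: "inner_on A u ?w = sqnorm A (kernel_op A k u)"
    by (simp add: inner_on_kernel_op[symmetric] inner_on_self)
  have ip': "Re (inner_on A u (\<lambda>n. complex_of_real (- t) * ?w n)) = - t * sqnorm A (kernel_op A k u)"
    unfolding inner_on_commute[of A u "\<lambda>n. complex_of_real (- t) * ?w n"] inner_on_scale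
      inner_on_commute[of A ?w u] ip by simp
  have "sqnorm A (\<lambda>n. u n - complex_of_real t * ?w n) = sqnorm A (\<lambda>n. u n + complex_of_real (- t) * ?w n)"
    by simp
  also have "\<dots> = sqnorm A u - 2 * t * sqnorm A (kernel_op A k u) + t\<^sup>2 * sqnorm A ?w"
    by (subst sqnorm_add) (simp only: ip' sqnorm_scale, simp)
  also have "\<dots> \<le> sqnorm A u - 2 * t * sqnorm A (kernel_op A k u) + t\<^sup>2 * (?h * sqnorm A (kernel_op A k u))"
    using sqnorm_kernel_op_le[of A "adjoint_kernel k" "kernel_op A k u"] by (simp add: mult_left_mono)
  also have "t\<^sup>2 * (?h * sqnorm A (kernel_op A k u)) = (t * ?h) * (t * sqnorm A (kernel_op A k u))"
    by (simp add: power2_eq_square)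
  also have "\<dots> \<le> t * sqnorm A (kernel_op A k u)"
    using th t0 by (intro mult_left_le_one_le) (auto simp: t_def)
  finally have "sqnorm A (\<lambda>n. u n - complex_of_real t * ?w n) \<le> sqnorm A u - t * sqnorm A (kernel_op A k u)"
    by simp
  also have "\<dots> \<le> sqnorm A u - t * (c * sqnorm A u)"
    using c[of u] t0 by (simp add: mult_left_mono)
  finally show ?thesis by (simp add: algebra_simps)
qed

text \<open>In a difference of successive iterates the right-hand side \<open>f\<close> cancels, so
  the differences evolve under the contraction alone and no solution has to be known
  beforehand.\<close>

lemma landweber_diff:
  "landweber A k f (Suc (Suc j)) n - landweber A k f (Suc j) n =
     (let e = (\<lambda>n. landweber A k f (Suc j) n - landweber A k f j n) in
      e n - complex_of_real (1 / (1 + hs_sqnorm A k)) * kernel_op A (adjoint_kernel k) (kernel_op A k e) n)"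
proof -
  define x where "x = landweber A k f j"
  define y where "y = landweber A k f (Suc j)"
  have z: "landweber A k f (Suc (Suc j)) = landweber_step A k f y" and y: "y = landweber_step A k f x"
    by (simp_all add: y_def x_def landweber_def)
  have e: "kernel_op A k (\<lambda>n. y n - x n) = (\<lambda>n. (kernel_op A k y n - f n) - (kernel_op A k x n - f n))"
    by (simp add: kernel_op_diff)
  have "kernel_op A (adjoint_kernel k) (kernel_op A k (\<lambda>n. y n - x n)) n =
     kernel_op A (adjoint_kernel k) (\<lambda>m. kernel_op A k y m - f m) n
     - kernel_op A (adjoint_kernel k) (\<lambda>m. kernel_op A k x m - f m) n"
    unfolding e by (subst kernel_op_diff) simp
  moreover have "y n = x n - complex_of_real (1 / (1 + hs_sqnorm A k)) *
      kernel_op A (adjoint_kernel k) (\<lambda>m. kernel_op A k x m - f m) n"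
    by (simp only: y landweber_step_def)
  ultimately have "landweber_step A k f y n - y n = (y n - x n) - complex_of_real (1 / (1 + hs_sqnorm A k)) *
      kernel_op A (adjoint_kernel k) (kernel_op A k (\<lambda>n. y n - x n)) n"
    unfolding landweber_step_def by (simp add: right_diff_distrib)
  then show ?thesis
    by (simp add: z Let_def flip: x_def y_def)
qed

lemma landweber_outside: "n \<notin> A \<Longrightarrow> landweber A k f j n = 0"
  by (induction j) (simp_all add: landweber_def landweber_step_def kernel_op_def)

text \<open>The iterates are partial sums of their successive differences, which decay
  geometrically.\<close>

lemma landweber_convergent:
  assumes fin: "finite A" and c0: "c > 0" and c: "\<And>u. c * sqnorm A u \<le> sqnorm A (kernel_op A k u)"
  shows "convergent (\<lambda>j. landweber A k f j n)"
proof (cases "n \<in> A")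
  case False
  then show ?thesis by (simp add: landweber_outside convergent_const)
next
  case True
  let ?x = "landweber A k f"
  define t where "t = 1 / (1 + hs_sqnorm A k)"
  \<comment> \<open>The maximum with 0 spares a proof of t*c \<le> 1 and gives a nonnegative ratio
    that can be iterated.\<close>
  define q where "q = max 0 (1 - t * c)"
  have t0: "t > 0" by (simp add: t_def add_pos_nonneg)
  have q: "0 \<le> q" "q < 1" using t0 c0 by (auto simp: q_def)
  define e where "e j n = ?x (Suc j) n - ?x j n" for j n
  have estep: "sqnorm A (e (Suc j)) \<le> q * sqnorm A (e j)" for j
  proof -
    have "sqnorm A (e (Suc j)) \<le> (1 - t * c) * sqnorm A (e j)"
      using landweber_contraction[OF c, of "e j"]
      unfolding e_def landweber_diff Let_def t_def by simp
    also have "\<dots> \<le> q * sqnorm A (e j)" by (intro mult_right_mono) (auto simp: q_def)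
    finally show ?thesis .
  qed
  have epow: "sqnorm A (e j) \<le> q ^ j * sqnorm A (e 0)" for j
  proof (induction j)
    case (Suc j)
    then show ?case using order_trans[OF estep[of j] mult_left_mono[OF Suc q(1)]] by (simp add: mult.assoc)
  qed simp
  have "norm (e j n) \<le> sqrt q ^ j * sqrt (sqnorm A (e 0))" for j
  proof -
    have "(cmod (e j n))\<^sup>2 \<le> q ^ j * sqnorm A (e 0)"
      using cmod_sq_le_sqnorm[OF fin True, of "e j"] epow[of j] by linarith
    then have "cmod (e j n) \<le> sqrt (q ^ j * sqnorm A (e 0))" by (rule real_le_rsqrt)
    then show ?thesis by (simp add: real_sqrt_mult real_sqrt_power)
  qed
  then have "\<And>j. 0 \<le> j \<Longrightarrow> norm (e j n) \<le> sqrt q ^ j * sqrt (sqnorm A (e 0))"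
    by blast
  moreover have "summable (\<lambda>j. sqrt q ^ j * sqrt (sqnorm A (e 0)))"
    using q by (intro summable_mult2 summable_geometric) (simp add: real_sqrt_lt_1_iff)
  ultimately have "summable (\<lambda>j. e j n)"
    by (rule summable_comparison_test'[rotated])
  then have "(\<lambda>j. \<Sum>i<j. e i n) \<longlonglongrightarrow> (\<Sum>i. e i n)"
    by (rule summable_LIMSEQ)
  moreover have "(\<Sum>i<j. e i n) = ?x j n" for j
    unfolding e_def using sum_lessThan_telescope[of "\<lambda>i. ?x i n" j] by (simp add: landweber_def)
  ultimately show ?thesis by (auto simp: convergent_def)
qed

definition kernel_solve :: "'a set \<Rightarrow> ('a \<Rightarrow> 'a \<Rightarrow> complex) \<Rightarrow> ('a \<Rightarrow> complex) \<Rightarrow> 'a \<Rightarrow> complex" where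
  "kernel_solve A k f n = lim (\<lambda>j. landweber A k f j n)"

lemma kernel_solve_outside: "n \<notin> A \<Longrightarrow> kernel_solve A k f n = 0"
  by (simp add: kernel_solve_def landweber_outside)

text \<open>The limit is a fixed point of the step, which means that the adjoint annihilates the
  residual. The lower bound for the adjoint then makes the residual vanish on
  \<open>A\<close>.\<close>

lemma kernel_op_solve:
  assumes fin: "finite A" and c0: "c > 0" and c: "\<And>u. c * sqnorm A u \<le> sqnorm A (kernel_op A k u)"
    and c': "\<And>u. c * sqnorm A u \<le> sqnorm A (kernel_op A (adjoint_kernel k) u)"
    and n: "n \<in> A"
  shows "kernel_op A k (kernel_solve A k f) n = f n"
proof -
  let ?x = "landweber A k f" and ?y = "kernel_solve A k f"
  let ?t = "complex_of_real (1 / (1 + hs_sqnorm A k))"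
  have lim: "(\<lambda>j. ?x j n) \<longlonglongrightarrow> ?y n" for n
    unfolding kernel_solve_def using landweber_convergent[OF fin c0 c] by (simp add: convergent_LIMSEQ_iff)
  have limT: "(\<lambda>j. kernel_op A k (?x j) n) \<longlonglongrightarrow> kernel_op A k ?y n" for n
    unfolding kernel_op_def using lim by (cases "n \<in> A") (simp_all add: tendsto_sum tendsto_mult_left)
  have "(\<lambda>j. kernel_op A (adjoint_kernel k) (\<lambda>m. kernel_op A k (?x j) m - f m) n)
      \<longlonglongrightarrow> kernel_op A (adjoint_kernel k) (\<lambda>m. kernel_op A k ?y m - f m) n" for n
    unfolding kernel_op_def[of A "adjoint_kernel k"] using limT
    by (cases "n \<in> A") (simp_all add: tendsto_sum tendsto_mult_left tendsto_diff)
  then have "(\<lambda>j. ?x j n - ?t * kernel_op A (adjoint_kernel k) (\<lambda>m. kernel_op A k (?x j) m - f m) n)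
      \<longlonglongrightarrow> ?y n - ?t * kernel_op A (adjoint_kernel k) (\<lambda>m. kernel_op A k ?y m - f m) n" for n
    by (intro tendsto_diff lim tendsto_mult tendsto_const)
  then have "(\<lambda>j. ?x (Suc j) n) \<longlonglongrightarrow> ?y n - ?t * kernel_op A (adjoint_kernel k) (\<lambda>m. kernel_op A k ?y m - f m) n" for n
    by (simp add: landweber_def landweber_step_def)
  moreover have "(\<lambda>j. ?x (Suc j) n) \<longlonglongrightarrow> ?y n" for n
    using lim by (rule LIMSEQ_Suc)
  ultimately have "?y n = ?y n - ?t * kernel_op A (adjoint_kernel k) (\<lambda>m. kernel_op A k ?y m - f m) n" for n
    by (rule LIMSEQ_unique[rotated])
  moreover have "?t \<noteq> 0"
    using add_pos_nonneg[OF zero_less_one hs_sqnorm_nonneg[of A k]] by (simp only: of_real_eq_0_iff)  simp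
  ultimately have "kernel_op A (adjoint_kernel k) (\<lambda>m. kernel_op A k ?y m - f m) n = 0" for n
    by simp
  then have "sqnorm A (kernel_op A (adjoint_kernel k) (\<lambda>m. kernel_op A k ?y m - f m)) = 0"
    by (simp add: sqnorm_def)
  then have "c * sqnorm A (\<lambda>m. kernel_op A k ?y m - f m) \<le> 0"
    using c'[of "\<lambda>m. kernel_op A k ?y m - f m"] by simp
  then have "sqnorm A (\<lambda>m. kernel_op A k ?y m - f m) = 0"
    using c0 by (intro antisym sqnorm_nonneg) (simp add: mult_le_0_iff)
  then show ?thesis using n fin by (simp add: sqnorm_eq_0_iff)
qed

section \<open>Measurable dependence of solutions on parameters\<close>

lemma measurable_kernel_op:
  assumes "\<And>n m. n \<in> A \<Longrightarrow> m \<in> A \<Longrightarrow> (\<lambda>w. k w n m) \<in> borel_measurable N"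
    and "\<And>n. n \<in> A \<Longrightarrow> (\<lambda>w. u w n) \<in> borel_measurable N"
  shows "(\<lambda>w. kernel_op A (k w) (u w) n) \<in> borel_measurable N"
  using assms by (cases "n \<in> A") (auto simp: kernel_op_def)

text \<open>A pointwise limit of measurable iterates. The lower bound may vary with
  \<open>w\<close>, since only convergence at each \<open>w\<close> enters.\<close>

lemma measurable_kernel_solve:
  assumes k: "\<And>n m. n \<in> A \<Longrightarrow> m \<in> A \<Longrightarrow> (\<lambda>w. k w n m) \<in> borel_measurable N"
    and fin: "finite A"
    and c: "\<And>w. w \<in> space N \<Longrightarrow> \<exists>c>0. \<forall>u. c * sqnorm A u \<le> sqnorm A (kernel_op A (k w) u)"
  shows "(\<lambda>w. kernel_solve A (k w) f n) \<in> borel_measurable N"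
proof -
  have k': "(\<lambda>w. adjoint_kernel (k w) n m) \<in> borel_measurable N" if "n \<in> A" "m \<in> A" for n m
    unfolding adjoint_kernel_def
    by (rule measurable_compose[OF k[OF that(2,1)]]) (intro borel_measurable_continuous_onI continuous_intros)
  have h: "(\<lambda>w. 1 / (1 + hs_sqnorm A (k w))) \<in> borel_measurable N"
    unfolding hs_sqnorm_def using k by measurable
  have m: "(\<lambda>w. landweber A (k w) f j n) \<in> borel_measurable N" for j n
  proof (induction j arbitrary: n)
    case 0
    then show ?case by (simp add: landweber_def)
  next
    case (Suc j)
    have "(\<lambda>w. kernel_op A (k w) (landweber A (k w) f j) m - f m) \<in> borel_measurable N" for m
      using measurable_kernel_op[OF k Suc, where n = m] by measurable
    then have "(\<lambda>w. kernel_op A (adjoint_kernel (k w)) (\<lambda>m. kernel_op A (k w) (landweber A (k w) f j) m - f m) n)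
        \<in> borel_measurable N"
      by (intro measurable_kernel_op k')
    then have "(\<lambda>w. landweber_step A (k w) f (landweber A (k w) f j) n) \<in> borel_measurable N"
      unfolding landweber_step_def
      by (intro borel_measurable_diff Suc borel_measurable_times measurable_compose[OF h borel_measurable_of_real])
    then show ?case by (simp add: landweber_def)
  qed
  show ?thesis
  proof (rule borel_measurable_LIMSEQ_metric[OF m])
    fix w assume "w \<in> space N"
    then obtain c where "c > 0" "\<And>u. c * sqnorm A u \<le> sqnorm A (kernel_op A (k w) u)" using c by blast
    from landweber_convergent[OF fin this]
    show "(\<lambda>j. landweber A (k w) f j n) \<longlonglongrightarrow> kernel_solve A (k w) f n"
      unfolding kernel_solve_def by (simp add: convergent_LIMSEQ_iff)
  qed
qed

section \<open>Spectrum of a Hermitian kernel\<close>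

definition shift_kernel :: "('a \<Rightarrow> 'a \<Rightarrow> complex) \<Rightarrow> complex \<Rightarrow> 'a \<Rightarrow> 'a \<Rightarrow> complex" where
  "shift_kernel h z n m = h n m - (if n = m then z else 0)"

definition site :: "'a \<Rightarrow> 'a \<Rightarrow> complex" where
  "site p n = (if n = p then 1 else 0)"

lemma adjoint_shift_kernel:
  "adjoint_kernel h = h \<Longrightarrow> adjoint_kernel (shift_kernel h z) = shift_kernel h (cnj z)"
  by (intro ext) (auto simp: adjoint_kernel_def shift_kernel_def fun_eq_iff)

lemma kernel_op_shift:
  assumes "finite A" "n \<in> A"
  shows "kernel_op A (shift_kernel h z) u n = kernel_op A h u n - z * u n"
proof -
  have "(\<Sum>m\<in>A. (if n = m then z else 0) * u m) = (\<Sum>m\<in>A. if n = m then z * u m else 0)"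
    by (intro sum.cong) auto
  also have "\<dots> = z * u n"
    using assms by simp
  finally show ?thesis
    using assms by (simp add: kernel_op_def shift_kernel_def left_diff_distrib sum_subtractf)
qed

lemma sqnorm_kernel_op_shift:
  "finite A \<Longrightarrow> sqnorm A (kernel_op A (shift_kernel h z) u) = sqnorm A (\<lambda>n. kernel_op A h u n - z * u n)"
  by (rule sqnorm_cong) (simp add: kernel_op_shift)

lemma inner_on_hermitian_real:
  assumes "adjoint_kernel h = h"
  shows "Im (inner_on A (kernel_op A h u) u) = 0"
proof -
  have "inner_on A (kernel_op A h u) u = cnj (inner_on A (kernel_op A h u) u)"
    using inner_on_kernel_op[of A h u u] inner_on_commute[of A "kernel_op A h u" u] assms by simp
  from arg_cong[OF this, of Im] show ?thesis by simp
qed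

text \<open>The right-hand side depends on \<open>z\<close> only through its real part and modulus,
  so the shifts by \<open>z\<close> and by \<open>cnj z\<close> have equal norms. This normality is
  what transfers lower bounds to the adjoint.\<close>

lemma sqnorm_hermitian_shift:
  assumes fin: "finite A" and h: "adjoint_kernel h = h"
  shows "sqnorm A (kernel_op A (shift_kernel h z) u) =
    sqnorm A (kernel_op A h u) - 2 * Re z * Re (inner_on A (kernel_op A h u) u) + (cmod z)\<^sup>2 * sqnorm A u"
proof -
  have "inner_on A (kernel_op A h u) (\<lambda>n. (- z) * u n) = - cnj z * inner_on A (kernel_op A h u) u"
    by (subst inner_on_commute) (simp only: inner_on_scale inner_on_commute[of A "kernel_op A h u" u], simp)
  then have "Re (inner_on A (kernel_op A h u) (\<lambda>n. (- z) * u n)) = - Re z * Re (inner_on A (kernel_op A h u) u)"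
    using inner_on_hermitian_real[OF h, of A u] by simp
  moreover have "sqnorm A (kernel_op A (shift_kernel h z) u) = sqnorm A (\<lambda>n. kernel_op A h u n + (- z) * u n)"
    using sqnorm_kernel_op_shift[OF fin] by simp
  ultimately show ?thesis
    by (simp only: sqnorm_add sqnorm_scale) simp
qed

text \<open>Splitting |z|^2 into squares of real and imaginary part leaves a square, the norm for
  the shift by Re z. The bound makes the resolvent exist at every nonreal \<open>z\<close>.\<close>

lemma sqnorm_hermitian_shift_ge:
  assumes fin: "finite A" and h: "adjoint_kernel h = h"
  shows "(Im z)\<^sup>2 * sqnorm A u \<le> sqnorm A (kernel_op A (shift_kernel h z) u)"
proof -
  have "sqnorm A (kernel_op A (shift_kernel h z) u) =
      sqnorm A (kernel_op A (shift_kernel h (complex_of_real (Re z))) u) + (Im z)\<^sup>2 * sqnorm A u"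
    unfolding sqnorm_hermitian_shift[OF fin h] by (simp add: cmod_power2 algebra_simps)
  then show ?thesis by simp
qed

text \<open>The lower bound gives injectivity; by normality it holds for the adjoint too, and
  \<open>kernel_op_solve\<close> gives surjectivity. Contrapositively, spectral points have
  approximate eigenvectors of any quality.\<close>

lemma bij_betw_kernel_op_minus:
  assumes fin: "finite A" and h: "adjoint_kernel h = h" and c0: "c > 0"
    and c: "\<And>u. c * sqnorm A u \<le> sqnorm A (kernel_op A (shift_kernel h z) u)"
  shows "bij_betw (\<lambda>u n. kernel_op A h u n - z * u n) {u. \<forall>n. n \<notin> A \<longrightarrow> u n = 0} {u. \<forall>n. n \<notin> A \<longrightarrow> u n = 0}"
    (is "bij_betw ?T ?S ?S")
proof (rule bij_betw_imageI)
  let ?k = "shift_kernel h z"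
  have T: "?T u = kernel_op A ?k u" if "u \<in> ?S" for u
  proof
    fix n show "kernel_op A h u n - z * u n = kernel_op A ?k u n"
      using that by (cases "n \<in> A") (simp_all add: kernel_op_shift[OF fin], simp add: kernel_op_def)
  qed
  have c': "c * sqnorm A u \<le> sqnorm A (kernel_op A (adjoint_kernel ?k) u)" for u
    using c[of u] unfolding adjoint_shift_kernel[OF h] sqnorm_hermitian_shift[OF fin h] by simp
  show "inj_on ?T ?S"
  proof (rule inj_onI)
    fix u v assume u: "u \<in> ?S" and v: "v \<in> ?S" and eq: "?T u = ?T v"
    have "kernel_op A ?k (\<lambda>n. u n - v n) = (\<lambda>_. 0)"
      using eq unfolding T[OF u] T[OF v] kernel_op_diff by simp
    then have "c * sqnorm A (\<lambda>n. u n - v n) \<le> 0"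
      using c[of "\<lambda>n. u n - v n"] by (simp add: sqnorm_def)
    then have "sqnorm A (\<lambda>n. u n - v n) = 0"
      using c0 by (intro antisym sqnorm_nonneg) (simp add: mult_le_0_iff)
    then show "u = v"
      using u v by (auto simp: sqnorm_eq_0_iff[OF fin] fun_eq_iff)
  qed
  show "?T ` ?S = ?S"
  proof (intro equalityI subsetI)
    fix f assume "f \<in> ?T ` ?S"
    then show "f \<in> ?S" by (auto simp: kernel_op_def)
  next
    fix f assume f: "f \<in> ?S"
    have s: "kernel_solve A ?k f \<in> ?S" by (simp add: kernel_solve_outside)
    have "kernel_op A ?k (kernel_solve A ?k f) = f"
    proof
      fix n show "kernel_op A ?k (kernel_solve A ?k f) n = f n"
        using kernel_op_solve[OF fin c0 c c'] f by (cases "n \<in> A") (simp_all add: kernel_op_def)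
    qed
    then have "f = ?T (kernel_solve A ?k f)" using T[OF s] by simp
    then show "f \<in> ?T ` ?S" using s by (rule image_eqI)
  qed
qed

section \<open>Existence of an eigenvector by compactness\<close>

lemma compact_unit_functions:
  fixes A :: "'a set"
  shows "compact {u :: 'a \<Rightarrow> complex. (\<forall>n\<in>A. cmod (u n) \<le> 1) \<and> (\<forall>n. n \<notin> A \<longrightarrow> u n = 0)}"
proof -
  \<comment> \<open>Tychonoff: discs at the sites of \<open>A\<close> and singletons elsewhere, in
    the topology of pointwise convergence.\<close>
  have "compactin (product_topology (\<lambda>_. euclidean) UNIV) (PiE UNIV (\<lambda>n. if n \<in> A then cball (0::complex) 1 else {0}))"
    by (subst compactin_PiE) auto
  then have "compact (PiE UNIV (\<lambda>n. if n \<in> A then cball (0::complex) 1 else {0}))"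
    by (simp add: euclidean_product_topology flip: compactin_euclidean_iff)
  moreover have "PiE UNIV (\<lambda>n. if n \<in> A then cball (0::complex) 1 else {0}) =
      {u. (\<forall>n\<in>A. cmod (u n) \<le> 1) \<and> (\<forall>n. n \<notin> A \<longrightarrow> u n = 0)}"
    by (auto simp: PiE_UNIV_domain Pi_iff split: if_splits)
  ultimately show ?thesis by simp
qed

lemma continuous_on_sqnorm: "continuous_on S (\<lambda>u. sqnorm A u)"
  unfolding sqnorm_def by (intro continuous_intros continuous_on_subset[OF continuous_on_product_coordinates]) auto

lemma continuous_on_sqnorm_kernel_op: "continuous_on S (\<lambda>u. sqnorm A (kernel_op A k u))"
proof -
  have "sqnorm A (kernel_op A k u) = (\<Sum>n\<in>A. (cmod (\<Sum>m\<in>A. k n m * u m))\<^sup>2)" for u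
    by (simp add: sqnorm_def kernel_op_def)
  then show ?thesis
    by (simp only:) (intro continuous_intros continuous_on_subset[OF continuous_on_product_coordinates]; auto)
qed

text \<open>
  A unit vector \<open>u\<close> maximising \<open>\<parallel>T u\<parallel>\<close>, with maximum \<open>b\<close>, satisfies \<open>T\<^sup>2 u = b\<^sup>2 u\<close>, and
  \<open>T\<^sup>2 - b\<^sup>2 = (T - b) (T + b)\<close>.
\<close>

lemma hermitian_has_eigenvector:
  assumes fin: "finite A" and ne: "A \<noteq> {}" and h: "adjoint_kernel h = h"
  obtains z u where "sqnorm A u > 0" "\<And>n. n \<notin> A \<Longrightarrow> u n = 0" "\<And>n. n \<in> A \<Longrightarrow> kernel_op A h u n = z * u n"
proof -
  let ?T = "kernel_op A h"
  define K where "K = {u :: 'a \<Rightarrow> complex. (\<forall>n\<in>A. cmod (u n) \<le> 1) \<and> (\<forall>n. n \<notin> A \<longrightarrow> u n = 0)}"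
  define U where "U = K \<inter> {u. sqnorm A u = 1}"
  have "closed {u :: 'a \<Rightarrow> complex. sqnorm A u = 1}"
    using continuous_closed_preimage_constant[OF continuous_on_sqnorm, of UNIV A 1] by simp
  then have "compact U"
    unfolding U_def K_def by (intro compact_Int_closed compact_unit_functions)
  moreover from ne obtain p where p: "p \<in> A" by blast
  have "sqnorm A (site p) = (\<Sum>n\<in>A. if n = p then 1 else 0)"
    unfolding sqnorm_def by (intro sum.cong) (auto simp: site_def)
  then have "sqnorm A (site p) = 1"
    using p fin by simp
  then have "site p \<in> U"
    using p by (auto simp: U_def K_def site_def)
  then have "U \<noteq> {}" by blast
  ultimately obtain u where u: "u \<in> U" and max: "\<And>v. v \<in> U \<Longrightarrow> sqnorm A (?T v) \<le> sqnorm A (?T u)"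
    using continuous_attains_sup[OF _ _ continuous_on_sqnorm_kernel_op, of U A h] by blast
  define b where "b = sqrt (sqnorm A (?T u))"
  have b2: "b\<^sup>2 = sqnorm A (?T u)" by (simp add: b_def)
  \<comment> \<open>The maximum over the unit sphere extends to all \<open>v\<close> by scaling;
    vectors of norm 0 cannot be normalised and are treated apart.\<close>
  have bound: "sqnorm A (?T v) \<le> b\<^sup>2 * sqnorm A v" if v: "\<And>n. n \<notin> A \<Longrightarrow> v n = 0" for v
  proof (cases "sqnorm A v = 0")
    case True
    then show ?thesis using sqnorm_kernel_op_le[of A h v] by simp
  next
    case False
    define s where "s = sqnorm A v"
    have s: "s > 0" using False by (simp add: s_def less_le)
    let ?v = "\<lambda>n. complex_of_real (1 / sqrt s) * v n"
    have n1: "sqnorm A ?v = 1"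
      unfolding sqnorm_scale using s by (simp add: s_def[symmetric] norm_divide power_divide)
    have "cmod (?v n) \<le> 1" if "n \<in> A" for n
      using cmod_sq_le_sqnorm[OF fin that, of ?v] n1 abs_le_square_iff[of "cmod (?v n)" 1] by simp
    then have "?v \<in> U" using n1 v by (auto simp: U_def K_def)
    from max[OF this] have "(1 / s) * sqnorm A (?T v) \<le> b\<^sup>2"
      unfolding b2 kernel_op_scale sqnorm_scale using s by (simp add: norm_divide power_divide)
    then show ?thesis using s by (simp add: s_def[symmetric] field_simps)
  qed
  have u1: "sqnorm A u = 1" and u0: "\<And>n. n \<notin> A \<Longrightarrow> u n = 0" using u by (auto simp: U_def K_def)
  have T0: "?T v n = 0" if "n \<notin> A" for v n using that by (simp add: kernel_op_def)
  \<comment> \<open>With |u| = 1 and |Tu| = b, expanding |T^2 u - b^2 u|^2 gives |T^2 u|^2 - b^4,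
    and this is at most 0 by \<open>bound\<close> applied to Tu.\<close>
  have "inner_on A (?T (?T u)) u = complex_of_real (b\<^sup>2)"
    using inner_on_kernel_op[of A h "?T u" u] h b2 by (simp add: inner_on_self)
  then have "inner_on A (?T (?T u)) (\<lambda>n. complex_of_real (- b\<^sup>2) * u n) = complex_of_real (- b\<^sup>2 * b\<^sup>2)"
    by (subst inner_on_commute) (simp only: inner_on_scale inner_on_commute[of A "?T (?T u)" u], simp)
  then have "sqnorm A (\<lambda>n. ?T (?T u) n + complex_of_real (- b\<^sup>2) * u n) = sqnorm A (?T (?T u)) - b\<^sup>2 * b\<^sup>2"
    by (simp only: sqnorm_add sqnorm_scale u1)
       (simp add: norm_mult power2_eq_square)
  also have "\<dots> \<le> 0"
    using bound[of "?T u"] T0 b2 by (simp add: power2_eq_square)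
  finally have "sqnorm A (\<lambda>n. ?T (?T u) n + complex_of_real (- b\<^sup>2) * u n) = 0"
    by (intro antisym sqnorm_nonneg)
  then have sq: "?T (?T u) n = complex_of_real (b\<^sup>2) * u n" if "n \<in> A" for n
    using that by (simp add: sqnorm_eq_0_iff[OF fin])
  \<comment> \<open>Since (T - b) w = 0 on \<open>A\<close>, either \<open>w\<close> is an
    eigenvector for \<open>b\<close>, or it vanishes and \<open>u\<close> is one for
    \<open>-b\<close>.\<close>
  define w where "w n = ?T u n + complex_of_real b * u n" for n
  show thesis
  proof (cases "sqnorm A w = 0")
    case True
    then have "?T u n = complex_of_real (- b) * u n" if "n \<in> A" for n
      using that by (simp add: sqnorm_eq_0_iff[OF fin] w_def eq_neg_iff_add_eq_0)
    then show thesis using that[of u "complex_of_real (- b)"] u1 u0 by simp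
  next
    case False
    have "?T w n = complex_of_real b * w n" if "n \<in> A" for n
      using sq[OF that] unfolding w_def kernel_op_add kernel_op_scale
      by (simp add: distrib_left power2_eq_square)
    then show thesis
      using that[of w "complex_of_real b"] False u0 T0 by (simp add: w_def less_le)
  qed
qed

section \<open>Distance to the spectrum and approximate eigenvectors\<close>

lemma ell2_finite: "finite A \<Longrightarrow> ell2 A = {u. \<forall>n. n \<notin> A \<longrightarrow> u n = 0}"
  by (simp add: ell2_def)

text \<open>At a spectral point near \<open>E\<close> no lower bound for the shifted operator can
  hold, and a violating vector is normalised. The factor 2 leaves room both for choosing that point
  strictly within 2\<eta> and for the error of the vector.\<close>

lemma infdist_spectrum_approximate_eigenvector:
  fixes A :: "(int ^ 'd) set"
  assumes fin: "finite A" and ne: "A \<noteq> {}" and h: "adjoint_kernel h = h" and \<eta>: "\<eta> > 0"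
    and near: "infdist (complex_of_real E) (op_spectrum A (kernel_op A h)) \<le> \<eta>"
  obtains u where "sqnorm A u = 1" "\<And>n. n \<notin> A \<Longrightarrow> u n = 0"
    "sqnorm A (kernel_op A (shift_kernel h (complex_of_real E)) u) \<le> (2 * \<eta>)\<^sup>2"
proof -
  let ?\<sigma> = "op_spectrum A (kernel_op A h)" and ?E = "complex_of_real E"
  let ?S = "{u :: int ^ 'd \<Rightarrow> complex. \<forall>n. n \<notin> A \<longrightarrow> u n = 0}"
  obtain z0 w where w: "sqnorm A w > 0" "\<And>n. n \<notin> A \<Longrightarrow> w n = 0" "\<And>n. n \<in> A \<Longrightarrow> kernel_op A h w n = z0 * w n"
    by (rule hermitian_has_eigenvector[OF fin ne h]) blast
  \<comment> \<open>By convention \<open>infdist\<close> to the empty set is 0, so the spectrum must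
    be shown nonempty before a nearby point can be extracted.\<close>
  have "z0 \<in> ?\<sigma>"
  proof (rule ccontr)
    assume "z0 \<notin> ?\<sigma>"
    then have inj: "inj_on (\<lambda>u n. kernel_op A h u n - z0 * u n) ?S"
      unfolding op_spectrum_def ell2_finite[OF fin] by (auto dest: bij_betw_imp_inj_on)
    have "(\<lambda>n. kernel_op A h w n - z0 * w n) = (\<lambda>n. kernel_op A h (\<lambda>_. 0) n - z0 * 0)"
    proof
      fix n show "kernel_op A h w n - z0 * w n = kernel_op A h (\<lambda>_. 0) n - z0 * 0"
        using w(2,3)[of n] by (cases "n \<in> A") (simp_all add: kernel_op_def)
    qed
    then have "w = (\<lambda>_. 0)"
      using inj_onD[OF inj, of w "\<lambda>_. 0"] w(2) by simp
    then show False using w(1) by (simp add: sqnorm_def)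
  qed
  then have ne\<sigma>: "?\<sigma> \<noteq> {}" by blast
  have "infdist ?E ?\<sigma> < 2 * \<eta>" using near \<eta> by simp
  then obtain z where z: "z \<in> ?\<sigma>" "dist ?E z < 2 * \<eta>"
    using ne\<sigma> by (auto simp: infdist_def cINF_less_iff)
  \<comment> \<open>The remaining room. An error of half of it at \<open>z\<close>, plus the cost
    \<open>dist ?E z\<close> of moving from \<open>z\<close> to \<open>E\<close>, stays below
    2\<eta>.\<close>
  let ?\<delta> = "2 * \<eta> - dist ?E z"
  have "\<not> (\<forall>u. (?\<delta>\<^sup>2 / 4) * sqnorm A u \<le> sqnorm A (kernel_op A (shift_kernel h z) u))"
  proof
    assume a: "\<forall>u. (?\<delta>\<^sup>2 / 4) * sqnorm A u \<le> sqnorm A (kernel_op A (shift_kernel h z) u)"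
    have "z \<notin> ?\<sigma>"
      unfolding op_spectrum_def ell2_finite[OF fin]
      using bij_betw_kernel_op_minus[OF fin h, of "?\<delta>\<^sup>2 / 4" z] a z(2) by auto
    then show False using z by simp
  qed
  then obtain v where v: "sqnorm A (kernel_op A (shift_kernel h z) v) < (?\<delta>\<^sup>2 / 4) * sqnorm A v"
    by (auto simp: not_le)
  define s where "s = sqnorm A v"
  have s: "s > 0"
    using v sqnorm_nonneg[of A "kernel_op A (shift_kernel h z) v"] sqnorm_nonneg[of A v]
    by (cases "sqnorm A v = 0") (simp_all add: s_def less_le del: sqnorm_nonneg)
  define u where "u n = (if n \<in> A then complex_of_real (1 / sqrt s) * v n else 0)" for n
  have "sqnorm A u = sqnorm A (\<lambda>n. complex_of_real (1 / sqrt s) * v n)"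
    by (rule sqnorm_cong) (simp add: u_def)
  then have u1: "sqnorm A u = 1"
    unfolding sqnorm_scale using s by (simp add: s_def[symmetric] norm_divide power_divide)
  have "kernel_op A (shift_kernel h z) u = kernel_op A (shift_kernel h z) (\<lambda>n. complex_of_real (1 / sqrt s) * v n)"
    by (rule kernel_op_cong) (simp add: u_def)
  then have "sqnorm A (kernel_op A (shift_kernel h z) u) = sqnorm A (kernel_op A (shift_kernel h z) v) / s"
    using s unfolding kernel_op_scale by (simp only: sqnorm_scale) (simp add: norm_divide power_divide)
  then have uz: "sqnorm A (kernel_op A (shift_kernel h z) u) \<le> (?\<delta> / 2)\<^sup>2"
    using v s by (simp add: s_def[symmetric] power_divide pos_divide_le_eq mult.commute less_imp_le)
  have "L2_set (\<lambda>n. cmod (kernel_op A (shift_kernel h ?E) u n)) A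
      \<le> L2_set (\<lambda>n. cmod (kernel_op A (shift_kernel h z) u n) + dist ?E z * cmod (u n)) A"
  proof (rule L2_set_mono)
    fix n assume n: "n \<in> A"
    have "kernel_op A (shift_kernel h ?E) u n = kernel_op A (shift_kernel h z) u n + (z - ?E) * u n"
      by (simp add: kernel_op_shift[OF fin n] algebra_simps)
    then show "cmod (kernel_op A (shift_kernel h ?E) u n) \<le> cmod (kernel_op A (shift_kernel h z) u n) + dist ?E z * cmod (u n)"
      by (metis dist_commute dist_norm norm_mult norm_triangle_ineq)
  qed simp
  also have "\<dots> \<le> L2_set (\<lambda>n. cmod (kernel_op A (shift_kernel h z) u n)) A + L2_set (\<lambda>n. dist ?E z * cmod (u n)) A"
    by (rule L2_set_triangle_ineq)
  also have "L2_set (\<lambda>n. dist ?E z * cmod (u n)) A = dist ?E z * sqrt (sqnorm A u)"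
    by (subst L2_set_right_distrib[symmetric]) (simp_all add: L2_set_def sqnorm_def)
  also have "L2_set (\<lambda>n. cmod (kernel_op A (shift_kernel h z) u n)) A \<le> ?\<delta> / 2"
    unfolding L2_set_def sqnorm_def[symmetric] using uz z(2) by (intro real_le_lsqrt) auto
  finally have "sqrt (sqnorm A (kernel_op A (shift_kernel h ?E) u)) \<le> ?\<delta> / 2 + dist ?E z"
    using u1 by (simp add: L2_set_def sqnorm_def)
  also have "\<dots> \<le> 2 * \<eta>"
    using less_imp_le[OF z(2)] by (simp add: field_simps)
  finally have "sqnorm A (kernel_op A (shift_kernel h ?E) u) \<le> (2 * \<eta>)\<^sup>2"
    using \<eta> by (subst (asm) real_sqrt_le_iff') auto
  then show thesis using that[of u] u1 by (simp add: u_def)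
qed

section \<open>Green functions and rank one perturbations\<close>

text \<open>Column \<open>p\<close> of the resolvent of \<open>h\<close> at \<open>z\<close>,
  extended by zero off \<open>A\<close>.\<close>

definition green :: "'a set \<Rightarrow> ('a \<Rightarrow> 'a \<Rightarrow> complex) \<Rightarrow> complex \<Rightarrow> 'a \<Rightarrow> 'a \<Rightarrow> complex" where
  "green A h z p = kernel_solve A (shift_kernel h z) (site p)"

lemma kernel_op_green:
  assumes fin: "finite A" and h: "adjoint_kernel h = h" and z: "Im z \<noteq> 0" and n: "n \<in> A"
  shows "kernel_op A (shift_kernel h z) (green A h z p) n = site p n"
  unfolding green_def
proof (rule kernel_op_solve[OF fin _ _ _ n])
  show "0 < (Im z)\<^sup>2" using z by simp
  show "(Im z)\<^sup>2 * sqnorm A u \<le> sqnorm A (kernel_op A (shift_kernel h z) u)" for u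
    by (rule sqnorm_hermitian_shift_ge[OF fin h])
  show "(Im z)\<^sup>2 * sqnorm A u \<le> sqnorm A (kernel_op A (adjoint_kernel (shift_kernel h z)) u)" for u
    unfolding adjoint_shift_kernel[OF h] using sqnorm_hermitian_shift_ge[OF fin h, of "cnj z" u] by simp
qed

lemma inner_on_site:
  assumes "finite A" "p \<in> A"
  shows "inner_on A u (site p) = u p"
proof -
  have "inner_on A u (site p) = (\<Sum>n\<in>A. if n = p then u n else 0)"
    unfolding inner_on_def by (intro sum.cong) (auto simp: site_def)
  then show ?thesis using assms by simp
qed

lemma inner_on_cong: "(\<And>n. n \<in> A \<Longrightarrow> v n = v' n) \<Longrightarrow> inner_on A u v = inner_on A u v'"
  by (simp add: inner_on_def)

lemma inner_on_green:
  assumes fin: "finite A" and h: "adjoint_kernel h = h" and z: "Im z \<noteq> 0" and p: "p \<in> A"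
  shows "inner_on A u (kernel_op A (shift_kernel h z) (green A h z p)) = u p"
proof -
  have "inner_on A u (kernel_op A (shift_kernel h z) (green A h z p)) = inner_on A u (site p)"
    by (rule inner_on_cong) (rule kernel_op_green[OF fin h z])
  then show ?thesis using inner_on_site[OF fin p] by simp
qed

text \<open>Pair \<open>u\<close> with the equation for the column at \<open>p\<close>, move the
  operator to \<open>u\<close>, where \<open>z\<close> turns into \<open>cnj z\<close>, and apply
  Cauchy-Schwarz; normality restores \<open>z\<close>.\<close>

lemma value_le_green:
  assumes fin: "finite A" and h: "adjoint_kernel h = h" and z: "Im z \<noteq> 0" and p: "p \<in> A"
  shows "(cmod (u p))\<^sup>2 \<le> sqnorm A (kernel_op A (shift_kernel h z) u) * sqnorm A (green A h z p)"
proof -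
  let ?k = "shift_kernel h z"
  have "u p = inner_on A u (kernel_op A ?k (green A h z p))"
    by (rule inner_on_green[OF fin h z p, symmetric])
  also have "\<dots> = inner_on A (kernel_op A (shift_kernel h (cnj z)) u) (green A h z p)"
    unfolding inner_on_kernel_op using adjoint_shift_kernel[OF h, of "cnj z"] by simp
  finally have "(cmod (u p))\<^sup>2 \<le> sqnorm A (kernel_op A (shift_kernel h (cnj z)) u) * sqnorm A (green A h z p)"
    using inner_on_Cauchy_Schwarz by metis
  then show ?thesis
    by (simp add: sqnorm_hermitian_shift[OF fin h])
qed

text \<open>Ward identity: pairing the column with its own equation gives a real number minus
  conj(z) times its squared norm.\<close>

lemma Im_green:
  assumes fin: "finite A" and h: "adjoint_kernel h = h" and z: "Im z \<noteq> 0" and p: "p \<in> A"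
  shows "Im (green A h z p p) = Im z * sqnorm A (green A h z p)"
proof -
  let ?g = "green A h z p" and ?k = "shift_kernel h z"
  have "?g p = inner_on A ?g (kernel_op A ?k ?g)"
    by (rule inner_on_green[OF fin h z p, symmetric])
  also have "\<dots> = inner_on A ?g (\<lambda>n. kernel_op A h ?g n + (- z) * ?g n)"
    by (rule inner_on_cong) (simp add: kernel_op_shift[OF fin])
  also have "\<dots> = cnj (inner_on A (kernel_op A h ?g) ?g) - cnj z * complex_of_real (sqnorm A ?g)"
    unfolding inner_on_commute[of A ?g "\<lambda>n. kernel_op A h ?g n + (- z) * ?g n"] inner_on_add inner_on_scale inner_on_self
    by simp
  finally show ?thesis
    using inner_on_hermitian_real[OF h, of A ?g] by simp
qed

text \<open>The perturbation acts only at \<open>p\<close>, so the old column solves the new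
  equation with right-hand side multiplied by 1 + v g(p); uniqueness gives the relation. The product
  form avoids dividing before the factor is known to be nonzero.\<close>

lemma green_rank_one:
  assumes fin: "finite A" and h: "adjoint_kernel h = h" and z: "Im z \<noteq> 0" and p: "p \<in> A"
    and h': "\<And>n m. h' n m = h n m + (if n = p \<and> m = p then complex_of_real v else 0)"
  shows "green A h' z p p * (1 + complex_of_real v * green A h z p p) = green A h z p p"
proof -
  let ?g = "green A h z p" and ?g' = "green A h' z p" and ?v = "complex_of_real v"
  have hh': "adjoint_kernel h' = h'"
    using fun_cong[OF fun_cong[OF h]] by (intro ext) (simp add: adjoint_kernel_def h')
  let ?c = "1 + ?v * ?g p"
  have "kernel_op A (shift_kernel h' z) ?g n = ?c * site p n" if n: "n \<in> A" for n
  proof -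
    have "(\<Sum>m\<in>A. (if n = p \<and> m = p then ?v else 0) * ?g m) = (\<Sum>m\<in>A. if m = p then (if n = p then ?v * ?g p else 0) else 0)"
      by (intro sum.cong) auto
    also have "\<dots> = ?v * ?g p * site p n"
      using fin p by (simp add: site_def)
    finally have "kernel_op A h' ?g n = kernel_op A h ?g n + ?v * ?g p * site p n"
      using n by (simp add: kernel_op_def h' distrib_right sum.distrib)
    then show ?thesis
      using kernel_op_green[OF fin h z n, of p] by (simp add: kernel_op_shift[OF fin n] algebra_simps)
  qed
  moreover have "kernel_op A (shift_kernel h' z) (\<lambda>n. ?c * ?g' n) n = ?c * site p n" if "n \<in> A" for n
    by (subst kernel_op_scale) (rule arg_cong[OF kernel_op_green[OF fin hh' z that]])
  ultimately have "sqnorm A (kernel_op A (shift_kernel h' z) (\<lambda>n. ?g n - ?c * ?g' n)) = 0"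
    unfolding kernel_op_diff by (simp add: sqnorm_def)
  then have "(Im z)\<^sup>2 * sqnorm A (\<lambda>n. ?g n - ?c * ?g' n) \<le> 0"
    using sqnorm_hermitian_shift_ge[OF fin hh', of z "\<lambda>n. ?g n - ?c * ?g' n"] by simp
  then have "sqnorm A (\<lambda>n. ?g n - ?c * ?g' n) = 0"
    using z by (intro antisym sqnorm_nonneg) (simp add: mult_le_0_iff)
  then have "?g p - ?c * ?g' p = 0"
    using p unfolding sqnorm_eq_0_iff[OF fin] by blast
  then show ?thesis
    by (simp only: right_minus_eq mult.commute[of "?g' p"])
qed

lemma nn_integral_Im_rank_one_le:
  fixes g :: complex
  assumes g: "Im g > 0" and M: "0 \<le> M"
  shows "(\<integral>\<^sup>+v. ennreal (Im (g / (1 + complex_of_real v * g))) * indicator {0..M} v \<partial>lborel) \<le> ennreal pi"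
proof -
  define r where "r = (cmod g)\<^sup>2"
  have r: "r > 0" "r = (Re g)\<^sup>2 + (Im g)\<^sup>2" using g by (auto simp: r_def cmod_power2 intro!: add_nonneg_pos)
  \<comment> \<open>Here 1/g = p - iq and g/(1 + vg) = 1/(v + 1/g), whence a Cauchy density in
    \<open>v\<close> centred at -p with width \<open>q\<close>; its primitive is an
    arctangent.\<close>
  define p where "p = Re g / r"
  define q where "q = Im g / r"
  have q: "q > 0" using g r by (simp add: q_def)
  have eq: "Im (g / (1 + complex_of_real v * g)) = q / ((v + p)\<^sup>2 + q\<^sup>2)" for v
  proof -
    let ?d = "(1 + v * Re g)\<^sup>2 + (v * Im g)\<^sup>2"
    have d: "?d = r * ((v + p)\<^sup>2 + q\<^sup>2)"
    proof -
      have "r * ((v + p)\<^sup>2 + q\<^sup>2) = r * v\<^sup>2 + 2 * v * (r * p) + r * (p\<^sup>2 + q\<^sup>2)"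
        by (simp add: power2_eq_square algebra_simps)
      also have "r * p = Re g" using r by (simp add: p_def)
      also have "p\<^sup>2 + q\<^sup>2 = r / r\<^sup>2"
        unfolding p_def q_def power_divide add_divide_distrib[symmetric] using r(2) by simp
      also have "r * (r / r\<^sup>2) = 1" using r(1) by (simp add: power2_eq_square)
      finally show ?thesis unfolding r(2) by (simp add: power2_eq_square algebra_simps)
    qed
    have "Im (g / (1 + complex_of_real v * g)) = Im g / ?d"
      by (simp add: Im_divide algebra_simps)
    also have "\<dots> = q / ((v + p)\<^sup>2 + q\<^sup>2)"
      unfolding d q_def by simp
    finally show ?thesis .
  qed
  have pos: "(v + p)\<^sup>2 + q\<^sup>2 > 0" for v using q by (simp add: add_nonneg_pos)
  have "(\<integral>\<^sup>+v. ennreal (q / ((v + p)\<^sup>2 + q\<^sup>2)) * indicator {0..M} v \<partial>lborel)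
      = ennreal (arctan ((M + p) / q) - arctan ((0 + p) / q))"
  proof (rule nn_integral_FTC_Icc)
    show "(\<lambda>v. q / ((v + p)\<^sup>2 + q\<^sup>2)) \<in> borel_measurable borel" by measurable
    fix v
    have "((\<lambda>v. arctan ((v + p) / q)) has_real_derivative (1 / q) * inverse (1 + ((v + p) / q)\<^sup>2)) (at v)"
      using q by (auto intro!: derivative_eq_intros)
    moreover have "(1 / q) * inverse (1 + ((v + p) / q)\<^sup>2) = q / ((v + p)\<^sup>2 + q\<^sup>2)"
      using q pos[of v] by (simp add: field_simps power2_eq_square)
    ultimately show "((\<lambda>v. arctan ((v + p) / q)) has_real_derivative q / ((v + p)\<^sup>2 + q\<^sup>2)) (at v)" by simp
    show "0 \<le> q / ((v + p)\<^sup>2 + q\<^sup>2)" using q pos[of v] by simp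
  qed (use M in auto)
  also have "\<dots> \<le> ennreal pi"
    using arctan_lbound[of "(0 + p) / q"] arctan_ubound[of "(M + p) / q"] by (intro ennreal_leI) linarith
  finally show ?thesis unfolding eq .
qed

section \<open>The lattice Laplacian and Delone sets\<close>

definition energy_bound :: "(int ^ 'd \<Rightarrow> complex) \<Rightarrow> real \<Rightarrow> bool" where
  "energy_bound u K \<longleftrightarrow> (\<forall>i X. finite X \<longrightarrow> sqnorm X (\<lambda>n. u (n + axis i 1) - u n) \<le> K)"

text \<open>Quantifying over all finite sets, here and in \<open>energy_bound\<close>, replaces sums
  over the whole lattice and makes the bounds invariant under translation.\<close>

definition shift_bound :: "int ^ 'd \<Rightarrow> real \<Rightarrow> bool" where
  "shift_bound s c \<longleftrightarrow>
     (\<forall>u K X. energy_bound u K \<longrightarrow> finite X \<longrightarrow> sqnorm X (\<lambda>n. u (n + s) - u n) \<le> c * K)"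

lemma sqnorm_translate: "sqnorm X (\<lambda>n. v (n + s)) = sqnorm ((\<lambda>n. n + s) ` X) (v :: int ^ 'd \<Rightarrow> complex)"
  by (simp add: sqnorm_def sum.reindex)

lemma sqnorm_minus_commute: "sqnorm X (\<lambda>n. u n - v n) = sqnorm X (\<lambda>n. v n - u n)"
  by (simp add: sqnorm_def norm_minus_commute)

lemma shift_bound_axis: "shift_bound (axis i 1) 1"
  by (simp add: shift_bound_def energy_bound_def)

lemma shift_bound_0: "shift_bound 0 0"
  by (simp add: shift_bound_def sqnorm_def)

lemma shift_bound_uminus: "shift_bound s c \<Longrightarrow> shift_bound (- s) c"
  unfolding shift_bound_def
proof (intro allI impI)
  fix u :: "int ^ 'a \<Rightarrow> complex" and K :: real and X :: "(int ^ 'a) set"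
  assume s: "\<forall>u K X. energy_bound u K \<longrightarrow> finite X \<longrightarrow> sqnorm X (\<lambda>n. u (n + s) - u n) \<le> c * K"
    and u: "energy_bound u K" and X: "finite X"
  have "sqnorm X (\<lambda>n. u (n + - s) - u n) = sqnorm ((\<lambda>n. n + - s) ` X) (\<lambda>n. u n - u (n + s))"
    using sqnorm_translate[of X "\<lambda>n. u n - u (n + s)" "- s"] by simp
  then show "sqnorm X (\<lambda>n. u (n + - s) - u n) \<le> c * K"
    using s u X sqnorm_minus_commute[of "(\<lambda>n. n + - s) ` X" u "\<lambda>n. u (n + s)"] by simp
qed

text \<open>Pass through the intermediate point n + t. The factors 2 come from |a + b|^2 \<le>
  2|a|^2 + 2|b|^2; the first difference is summed over the translated set.\<close>

lemma shift_bound_add: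
  assumes s: "shift_bound s c" and t: "shift_bound t d"
  shows "shift_bound (s + t) (2 * c + 2 * d)"
  unfolding shift_bound_def
proof (intro allI impI)
  fix u :: "int ^ 'a \<Rightarrow> complex" and K :: real and X :: "(int ^ 'a) set"
  assume u: "energy_bound u K" and X: "finite X"
  have "sqnorm X (\<lambda>n. u (n + (s + t)) - u n) =
      sqnorm X (\<lambda>n. (u (n + t + s) - u (n + t)) + (u (n + t) - u n))"
    by (simp add: add_ac)
  also have "\<dots> \<le> 2 * sqnorm X (\<lambda>n. u (n + t + s) - u (n + t)) + 2 * sqnorm X (\<lambda>n. u (n + t) - u n)"
    by (rule sqnorm_add_le)
  also have "sqnorm X (\<lambda>n. u (n + t + s) - u (n + t)) = sqnorm ((\<lambda>n. n + t) ` X) (\<lambda>n. u (n + s) - u n)"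
    by (rule sqnorm_translate)
  also have "\<dots> \<le> c * K" using s u X by (simp add: shift_bound_def)
  also have "sqnorm X (\<lambda>n. u (n + t) - u n) \<le> d * K" using t u X by (simp add: shift_bound_def)
  finally show "sqnorm X (\<lambda>n. u (n + (s + t)) - u n) \<le> (2 * c + 2 * d) * K"
    by (simp add: algebra_simps)
qed

text \<open>Compose unit steps along the axes. The constant may grow fast with the shift, which is
  harmless because the Poincare inequality uses finitely many shifts.\<close>

lemma shift_bound_exists: "\<exists>c. shift_bound s c"
proof -
  have add: "\<exists>c. shift_bound (s + t) c" if "\<exists>c. shift_bound s c" "\<exists>c. shift_bound t c" for s t :: "int ^ 'a"
    using that shift_bound_add by blast
  have nat: "\<exists>c. shift_bound (of_nat k *s axis i 1) c" for i :: 'a and k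
  proof (induction k)
    case 0
    have "of_nat 0 *s axis i (1::int) = 0" by (simp add: vec_eq_iff)
    then show ?case using shift_bound_0 by metis
  next
    case (Suc k)
    have "of_nat (Suc k) *s axis i (1::int) = axis i 1 + of_nat k *s axis i 1"
      by (simp add: vec_eq_iff algebra_simps)
    then show ?case using add[OF _ Suc, of "axis i 1"] shift_bound_axis by metis
  qed
  have int: "\<exists>c. shift_bound (k *s axis i 1) c" for i :: 'a and k :: int
  proof (cases "0 \<le> k")
    case True
    then show ?thesis using nat[of "nat k" i] by simp
  next
    case False
    then have "k *s axis i 1 = - (of_nat (nat (- k)) *s axis i 1)"
      by (simp add: vec_eq_iff)
    then show ?thesis using nat[of "nat (- k)" i] shift_bound_uminus by metis
  qed
  have "\<exists>c. shift_bound (\<Sum>i\<in>I. s $ i *s axis i 1) c" if "finite I" for I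
    using that
  proof (induction I)
    case empty
    then show ?case using shift_bound_0 by auto
  next
    case (insert i I)
    then show ?case using add[OF int insert.IH] by simp
  qed
  from this[of UNIV] show ?thesis by (simp only: basis_expansion) simp
qed

section \<open>Finiteness and size of lattice cubes and boxes\<close>

lemma coordinate_box_eq: "{n. \<forall>i. n $ i \<in> F i} = vec_lambda ` PiE UNIV F"
proof (intro equalityI subsetI)
  fix n assume "n \<in> {n. \<forall>i. n $ i \<in> F i}"
  then have "vec_nth n \<in> PiE UNIV F" by (simp add: PiE_UNIV_domain)
  then have "vec_lambda (vec_nth n) \<in> vec_lambda ` PiE UNIV F" by (rule imageI)
  then show "n \<in> vec_lambda ` PiE UNIV F" by (simp only: vec_lambda_eta)
qed (auto simp: PiE_UNIV_domain)

lemma finite_coordinate_box: "(\<And>i :: 'd :: finite. finite (F i)) \<Longrightarrow> finite {n :: 'a ^ 'd. \<forall>i. n $ i \<in> F i}"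
  unfolding coordinate_box_eq by (intro finite_imageI finite_PiE) auto

lemma card_coordinate_box_le:
  "(\<And>i :: 'd :: finite. finite (F i)) \<Longrightarrow> card {n :: 'a ^ 'd. \<forall>i. n $ i \<in> F i} \<le> (\<Prod>i\<in>UNIV. card (F i))"
  unfolding coordinate_box_eq
  by (rule order_trans[OF card_image_le]) (auto intro!: finite_PiE simp: card_PiE)

lemma finite_lattice_cube: "finite (lattice_cube R a)"
proof (rule finite_subset)
  show "lattice_cube R a \<subseteq> {n. \<forall>i. n $ i \<in> {a $ i .. a $ i + \<lceil>R\<rceil>}}"
  proof
    fix n assume n: "n \<in> lattice_cube R a"
    have "a $ i \<le> n $ i \<and> n $ i \<le> a $ i + \<lceil>R\<rceil>" for i
    proof -
      have "real_of_int (a $ i) \<le> real_of_int (n $ i)" "real_of_int (n $ i) \<le> real_of_int (a $ i) + R"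
        using n by (auto simp: lattice_cube_def)
      then show ?thesis using le_of_int_ceiling[of R] by linarith
    qed
    then show "n \<in> {n. \<forall>i. n $ i \<in> {a $ i .. a $ i + \<lceil>R\<rceil>}}" by simp
  qed
qed (rule finite_coordinate_box, simp)

lemma lattice_box_eq: "lattice_box L x = {n. \<forall>i. n $ i \<in> {x $ i - int L .. x $ i + int L}}"
proof -
  have "norm_max (n - x) \<le> int L \<longleftrightarrow> (\<forall>i. \<bar>n $ i - x $ i\<bar> \<le> int L)" for n
    unfolding norm_max_def by (subst Max_le_iff) auto
  then show ?thesis by (auto simp: lattice_box_def abs_le_iff algebra_simps)
qed

lemma finite_lattice_box: "finite (lattice_box L x)"
  unfolding lattice_box_eq by (rule finite_coordinate_box) simp

lemma center_in_lattice_box: "x \<in> lattice_box L x"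
  by (simp add: lattice_box_eq)

lemma card_lattice_box_le:
  fixes x :: "int ^ 'd"
  assumes "L \<ge> 1"
  shows "real (card (lattice_box L x)) \<le> 3 ^ CARD('d) * real L ^ CARD('d)"
proof -
  have "card (lattice_box L x) \<le> (\<Prod>i\<in>(UNIV :: 'd set). card {x $ i - int L .. x $ i + int L})"
    unfolding lattice_box_eq by (rule card_coordinate_box_le) simp
  also have "\<dots> = (2 * L + 1) ^ CARD('d)" by (simp add: nat_add_distrib nat_mult_distrib)
  \<comment> \<open>Uses 2L + 1 \<le> 3L for L \<ge> 1, which turns the volume into a multiple of
    L^d.\<close>
  also have "\<dots> \<le> (3 * L) ^ CARD('d)" using assms by (intro power_mono) auto
  finally have "real (card (lattice_box L x)) \<le> real ((3 * L) ^ CARD('d))" by (simp only: of_nat_le_iff)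
  then show ?thesis by (simp add: power_mult_distrib)
qed

section \<open>The discrete Poincare inequality\<close>

lemma sqnorm_delone_shift_le:
  fixes u :: "int ^ 'd \<Rightarrow> complex"
  assumes fin: "finite A" and u: "\<And>n. n \<notin> A \<Longrightarrow> u n = 0"
  shows "(\<Sum>n\<in>A. if n + s \<in> D then (cmod (u (n + s)))\<^sup>2 else 0) \<le> sqnorm (A \<inter> D) u"
proof -
  have "(\<Sum>n\<in>A. if n + s \<in> D then (cmod (u (n + s)))\<^sup>2 else 0) =
      (\<Sum>m\<in>(\<lambda>n. n + s) ` A. if m \<in> D then (cmod (u m))\<^sup>2 else 0)"
    by (simp add: sum.reindex)
  also have "\<dots> = (\<Sum>m\<in>(\<lambda>n. n + s) ` A \<inter> (A \<inter> D). (cmod (u m))\<^sup>2)"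
    using fin u by (intro sum.mono_neutral_cong_right) auto
  also have "\<dots> \<le> sqnorm (A \<inter> D) u"
    unfolding sqnorm_def using fin by (intro sum_mono2) auto
  finally show ?thesis .
qed

text \<open>
  Every site is joined to a point of \<open>D\<close> by one of finitely many shifts. Points of \<open>D\<close> outside \<open>A\<close>
  do no harm, as \<open>u\<close> vanishes there; hence there is no restriction on the size of \<open>A\<close>.
\<close>

lemma delone_poincare:
  fixes R :: real
  obtains C where "C > 0" "\<And>(D :: (int ^ 'd) set) A u K. delone R D \<Longrightarrow> finite A \<Longrightarrow> (\<And>n. n \<notin> A \<Longrightarrow> u n = 0) \<Longrightarrow>
     energy_bound u K \<Longrightarrow> sqnorm A u \<le> C * (sqnorm (A \<inter> D) u + K)"
proof -
  define S :: "(int ^ 'd) set" where "S = lattice_cube R 0"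
  have finS: "finite S" by (simp add: S_def finite_lattice_cube)
  obtain c where c: "\<And>s :: int ^ 'd. shift_bound s (c s)" using shift_bound_exists by metis
  \<comment> \<open>Each shift contributes 2 to the mass on \<open>D\<close> and 2|c s| to the
    energy; the summand 1 keeps \<open>C\<close> positive.\<close>
  define C where "C = 1 + 2 * real (card S) + 2 * (\<Sum>s\<in>S. \<bar>c s\<bar>)"
  have C: "C > 0" by (simp add: C_def sum_nonneg add_pos_nonneg)
  have "sqnorm A u \<le> C * (sqnorm (A \<inter> D) u + K)"
    if D: "delone R D" and fin: "finite A" and u: "\<And>n. n \<notin> A \<Longrightarrow> u n = 0" and K: "energy_bound u K"
    for D :: "(int ^ 'd) set" and A u K
  proof -
    have K0: "K \<ge> 0" using K unfolding energy_bound_def by (metis finite.emptyI order_trans sqnorm_nonneg)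
    \<comment> \<open>The shift that leads from \<open>n\<close> into \<open>D\<close> depends on
      \<open>n\<close>; summing over all of \<open>S\<close> removes this choice.\<close>
    have pt: "(cmod (u n))\<^sup>2 \<le> (\<Sum>s\<in>S. 2 * (if n + s \<in> D then (cmod (u (n + s)))\<^sup>2 else 0) + 2 * (cmod (u (n + s) - u n))\<^sup>2)" for n
    proof -
      have "lattice_cube R n \<inter> D \<noteq> {}" using D by (simp add: delone_def)
      then obtain m where m: "m \<in> lattice_cube R n" "m \<in> D" by blast
      have s: "m - n \<in> S" using m(1) unfolding S_def lattice_cube_def by (auto simp: diff_le_eq add.commute)
      have "(cmod (u n))\<^sup>2 \<le> (cmod (u m) + cmod (u m - u n))\<^sup>2"
        using norm_triangle_ineq4[of "u m" "u m - u n"] by (intro power_mono) auto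
      also have "\<dots> \<le> 2 * (cmod (u m))\<^sup>2 + 2 * (cmod (u m - u n))\<^sup>2"
        using sum_squares_bound[of "cmod (u m)" "cmod (u m - u n)"] by (simp add: power2_sum)
      also have "\<dots> \<le> (\<Sum>s\<in>S. 2 * (if n + s \<in> D then (cmod (u (n + s)))\<^sup>2 else 0) + 2 * (cmod (u (n + s) - u n))\<^sup>2)"
        using member_le_sum[OF s, of "\<lambda>s. 2 * (if n + s \<in> D then (cmod (u (n + s)))\<^sup>2 else 0) + 2 * (cmod (u (n + s) - u n))\<^sup>2"]
          finS m(2) by simp
      finally show ?thesis .
    qed
    have "sqnorm A u \<le> (\<Sum>n\<in>A. \<Sum>s\<in>S. 2 * (if n + s \<in> D then (cmod (u (n + s)))\<^sup>2 else 0) + 2 * (cmod (u (n + s) - u n))\<^sup>2)"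
      unfolding sqnorm_def by (intro sum_mono pt)
    also have "\<dots> = (\<Sum>s\<in>S. 2 * (\<Sum>n\<in>A. if n + s \<in> D then (cmod (u (n + s)))\<^sup>2 else 0) + 2 * sqnorm A (\<lambda>n. u (n + s) - u n))"
      by (subst sum.swap) (simp add: sum.distrib sum_distrib_left sqnorm_def)
    also have "\<dots> \<le> (\<Sum>s\<in>S. 2 * sqnorm (A \<inter> D) u + 2 * (\<bar>c s\<bar> * K))"
    proof (intro sum_mono add_mono mult_left_mono)
      fix s
      show "(\<Sum>n\<in>A. if n + s \<in> D then (cmod (u (n + s)))\<^sup>2 else 0) \<le> sqnorm (A \<inter> D) u"
        by (rule sqnorm_delone_shift_le[OF fin u])
      have "sqnorm A (\<lambda>n. u (n + s) - u n) \<le> c s * K"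
        using c[of s] K fin by (simp add: shift_bound_def)
      also have "\<dots> \<le> \<bar>c s\<bar> * K" using K0 by (intro mult_right_mono) auto
      finally show "sqnorm A (\<lambda>n. u (n + s) - u n) \<le> \<bar>c s\<bar> * K" .
    qed auto
    also have "\<dots> = 2 * real (card S) * sqnorm (A \<inter> D) u + 2 * (\<Sum>s\<in>S. \<bar>c s\<bar>) * K"
      by (simp add: sum.distrib sum_distrib_left sum_distrib_right mult.assoc)
    also have "\<dots> \<le> C * sqnorm (A \<inter> D) u + C * K"
      using K0 by (intro add_mono mult_right_mono) (auto simp: C_def sum_nonneg)
    finally show ?thesis by (simp add: distrib_left)
  qed
  with C show thesis using that by blast
qed

section \<open>Quadratic form of the Laplacian and matrix of the box Hamiltonian\<close>

lemma norm1_axis: "norm1 (axis i 1) = 1"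
  by (simp add: norm1_def axis_def if_distrib cong: if_cong)

lemma norm1_minus_commute: "norm1 (m - n) = norm1 (n - m)"
  by (simp add: norm1_def abs_minus_commute)

text \<open>Summation by parts: twice the form is the sum of |u(n) - u(m)|^2 over ordered pairs of
  neighbours, of which only the bonds in direction \<open>i\<close> starting in \<open>X\<close> are
  kept.\<close>

lemma energy_bound_neg_laplacian:
  fixes u :: "int ^ 'd \<Rightarrow> complex"
  assumes fin: "finite A" and u: "\<And>n. n \<notin> A \<Longrightarrow> u n = 0"
  shows "energy_bound u (2 * Re (inner_on A (neg_laplacian u) u))"
  unfolding energy_bound_def
proof (intro allI impI)
  fix i :: 'd and X :: "(int ^ 'd) set" assume X: "finite X"
  \<comment> \<open>A finite window large enough for every nonzero term of the form and for all the
    bonds to be kept.\<close>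
  define Y where "Y = A \<union> X \<union> (\<lambda>n. n + axis i 1) ` X \<union> (\<Union>n\<in>A. {m. norm1 (m - n) = 1})"
  have finY: "finite Y" using fin X by (simp add: Y_def finite_neighbours)
  define F where "F n m = (if norm1 (m - n) = 1 then (u n - u m) * cnj (u n) else 0)" for n m
  have "neg_laplacian u n * cnj (u n) = (\<Sum>m\<in>Y. F n m)" if "n \<in> A" for n
  proof -
    have "neg_laplacian u n * cnj (u n) = (\<Sum>m | norm1 (m - n) = 1. (u n - u m) * cnj (u n))"
      by (simp add: neg_laplacian_def sum_distrib_right flip: sum_negf)
    also have "\<dots> = (\<Sum>m\<in>Y. F n m)"
      using finY that by (intro sum.mono_neutral_cong_left) (auto simp: F_def Y_def)
    finally show ?thesis .
  qed
  then have "inner_on A (neg_laplacian u) u = (\<Sum>n\<in>A. \<Sum>m\<in>Y. F n m)"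
    by (simp add: inner_on_def)
  also have "\<dots> = (\<Sum>n\<in>Y. \<Sum>m\<in>Y. F n m)"
  proof (rule sum.mono_neutral_left[OF finY])
    show "A \<subseteq> Y" by (auto simp: Y_def)
    have "F n m = 0" if "n \<notin> A" for n m using u[OF that] by (simp add: F_def)
    then show "\<forall>n\<in>Y - A. (\<Sum>m\<in>Y. F n m) = 0" by simp
  qed
  finally have W: "inner_on A (neg_laplacian u) u = (\<Sum>n\<in>Y. \<Sum>m\<in>Y. F n m)" .
  \<comment> \<open>Symmetrising in \<open>n\<close> and \<open>m\<close> turns the cross terms into
    full squares.\<close>
  have "2 * inner_on A (neg_laplacian u) u = (\<Sum>n\<in>Y. \<Sum>m\<in>Y. F n m) + (\<Sum>n\<in>Y. \<Sum>m\<in>Y. F m n)"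
    unfolding W using sum.swap[of F Y Y] by simp
  also have "\<dots> = (\<Sum>n\<in>Y. \<Sum>m\<in>Y. F n m + F m n)"
    by (simp add: sum.distrib)
  also have "\<dots> = (\<Sum>n\<in>Y. \<Sum>m\<in>Y. complex_of_real (if norm1 (m - n) = 1 then (cmod (u n - u m))\<^sup>2 else 0))"
  proof (intro sum.cong refl)
    fix n m
    show "F n m + F m n = complex_of_real (if norm1 (m - n) = 1 then (cmod (u n - u m))\<^sup>2 else 0)"
      using norm1_minus_commute[of m n] unfolding F_def
      by (auto simp: complex_norm_square algebra_simps simp del: of_real_power)
  qed
  finally have "2 * Re (inner_on A (neg_laplacian u) u) =
      (\<Sum>n\<in>Y. \<Sum>m\<in>Y. if norm1 (m - n) = 1 then (cmod (u n - u m))\<^sup>2 else 0)"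
    by (simp only: of_real_sum[symmetric]) (simp add: complex_eq_iff)
  also have "\<dots> \<ge> (\<Sum>n\<in>X. \<Sum>m\<in>Y. if norm1 (m - n) = 1 then (cmod (u n - u m))\<^sup>2 else 0)"
    using finY by (intro sum_mono2) (auto simp: Y_def intro!: sum_nonneg)
  also have "(\<Sum>n\<in>X. \<Sum>m\<in>Y. if norm1 (m - n) = 1 then (cmod (u n - u m))\<^sup>2 else 0)
      \<ge> (\<Sum>n\<in>X. (cmod (u n - u (n + axis i 1)))\<^sup>2)"
  proof (rule sum_mono)
    fix n assume "n \<in> X"
    then have "n + axis i 1 \<in> Y" by (simp add: Y_def)
    from member_le_sum[OF this, of "\<lambda>m. if norm1 (m - n) = 1 then (cmod (u n - u m))\<^sup>2 else 0"] finY
    show "(cmod (u n - u (n + axis i 1)))\<^sup>2 \<le> (\<Sum>m\<in>Y. if norm1 (m - n) = 1 then (cmod (u n - u m))\<^sup>2 else 0)"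
      by (simp add: norm1_axis)
  qed
  finally show "sqnorm X (\<lambda>n. u (n + axis i 1) - u n) \<le> 2 * Re (inner_on A (neg_laplacian u) u)"
    by (simp add: sqnorm_def norm_minus_commute)
qed

text \<open>The diagonal carries the full lattice degree 2d even at the boundary of a box: bonds
  leaving the box lose their off-diagonal entry only, as the restriction by cutoffs
  prescribes.\<close>

definition box_kernel :: "(int ^ 'd) set \<Rightarrow> (int ^ 'd \<Rightarrow> real) \<Rightarrow> int ^ 'd \<Rightarrow> int ^ 'd \<Rightarrow> complex" where
  "box_kernel D \<omega> n m = complex_of_real
     (if n = m then real (card {m. norm1 (m - n) = 1}) + potential D \<omega> n
      else if norm1 (m - n) = 1 then - 1 else 0)"

lemma adjoint_box_kernel: "adjoint_kernel (box_kernel D \<omega>) = box_kernel D \<omega>"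
  by (intro ext) (simp add: adjoint_kernel_def box_kernel_def norm1_minus_commute)

lemma kernel_op_box_kernel:
  fixes u :: "int ^ 'd \<Rightarrow> complex"
  assumes fin: "finite A" and n: "n \<in> A" and u: "\<And>n. n \<notin> A \<Longrightarrow> u n = 0"
  shows "kernel_op A (box_kernel D \<omega>) u n = hamiltonian D \<omega> u n"
proof -
  let ?N = "{m. norm1 (m - n) = 1}" and ?d = "complex_of_real (real (card {m. norm1 (m - n) = 1}) + potential D \<omega> n)"
  have nn: "norm1 (n - n) \<noteq> 1" by (simp add: norm1_def)
  have "kernel_op A (box_kernel D \<omega>) u n = (\<Sum>m\<in>A. (if m = n then ?d * u n else 0) - (if norm1 (m - n) = 1 then u m else 0))"
    using n nn unfolding kernel_op_def box_kernel_def by (auto intro!: sum.cong)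
  also have "\<dots> = ?d * u n - (\<Sum>m\<in>A. if norm1 (m - n) = 1 then u m else 0)"
    using fin n by (simp add: sum_subtractf)
  also have "(\<Sum>m\<in>A. if norm1 (m - n) = 1 then u m else 0) = (\<Sum>m\<in>A \<inter> ?N. u m)"
    using fin by (intro sum.mono_neutral_cong_right) auto
  also have "\<dots> = (\<Sum>m\<in>?N. u m)"
    using finite_neighbours u by (intro sum.mono_neutral_left) auto
  also have "?d * u n - (\<Sum>m\<in>?N. u m) = hamiltonian D \<omega> u n"
    by (simp add: hamiltonian_def neg_laplacian_def sum_subtractf algebra_simps)
  finally show ?thesis .
qed

lemma box_hamiltonian_eq: "box_hamiltonian D \<omega> x L = kernel_op (lattice_box L x) (box_kernel D \<omega>)"
proof (intro ext)
  fix u n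
  let ?A = "lattice_box L x"
  have "kernel_op ?A (box_kernel D \<omega>) u = kernel_op ?A (box_kernel D \<omega>) (cutoff ?A u)"
    by (rule kernel_op_cong) (simp add: cutoff_def)
  then show "box_hamiltonian D \<omega> x L u n = kernel_op ?A (box_kernel D \<omega>) u n"
    using kernel_op_box_kernel[OF finite_lattice_box, of n L x "cutoff ?A u" D \<omega>]
    by (cases "n \<in> ?A") (simp_all add: box_hamiltonian_def cutoff_def kernel_op_def)
qed

lemma hamiltonian_form_ge:
  assumes fin: "finite A" and u: "\<And>n. n \<notin> A \<Longrightarrow> u n = 0" and \<omega>: "\<And>n. n \<in> A \<inter> D \<Longrightarrow> 0 \<le> \<omega> n"
  shows "Re (inner_on A (neg_laplacian u) u) \<le> Re (inner_on A (kernel_op A (box_kernel D \<omega>) u) u)"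
proof -
  have "kernel_op A (box_kernel D \<omega>) u n * cnj (u n) =
      neg_laplacian u n * cnj (u n) + complex_of_real (potential D \<omega> n * (cmod (u n))\<^sup>2)" if "n \<in> A" for n
    using kernel_op_box_kernel[OF fin that u]
    by (simp add: hamiltonian_def distrib_right complex_norm_square del: of_real_power)
  then have "inner_on A (kernel_op A (box_kernel D \<omega>) u) u =
      inner_on A (neg_laplacian u) u + complex_of_real (\<Sum>n\<in>A. potential D \<omega> n * (cmod (u n))\<^sup>2)"
    by (simp add: inner_on_def sum.distrib)
  moreover have "0 \<le> (\<Sum>n\<in>A. potential D \<omega> n * (cmod (u n))\<^sup>2)"
    using \<omega> by (intro sum_nonneg) (simp add: potential_def)
  ultimately show ?thesis by simp
qed

section \<open>The Wegner estimate\<close>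

lemma low_energy_mass_on_delone:
  assumes poinc: "\<And>u K. (\<And>n. n \<notin> A \<Longrightarrow> u n = 0) \<Longrightarrow> energy_bound u K \<Longrightarrow>
      sqnorm A u \<le> C * (sqnorm (A \<inter> D) u + K)"
    and C: "C > 0" and fin: "finite A" and \<omega>: "\<And>n. n \<in> A \<inter> D \<Longrightarrow> 0 \<le> \<omega> n"
    and \<eta>: "\<eta> \<ge> 0" and low: "2 * E + 4 * \<eta> \<le> 1 / (2 * C)"
    and u1: "sqnorm A u = 1" and u0: "\<And>n. n \<notin> A \<Longrightarrow> u n = 0"
    and approx: "sqnorm A (kernel_op A (shift_kernel (box_kernel D \<omega>) (complex_of_real E)) u) \<le> (2 * \<eta>)\<^sup>2"
  shows "1 / (2 * C) \<le> sqnorm (A \<inter> D) u"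
proof -
  let ?h = "box_kernel D \<omega>" and ?v = "kernel_op A (shift_kernel (box_kernel D \<omega>) (complex_of_real E)) u"
  have "inner_on A (kernel_op A ?h u) u = inner_on A (\<lambda>n. ?v n + complex_of_real E * u n) u"
    by (simp add: inner_on_def kernel_op_shift[OF fin])
  also have "\<dots> = inner_on A ?v u + complex_of_real E"
    unfolding inner_on_add inner_on_scale inner_on_self u1 by simp
  finally have "Re (inner_on A (kernel_op A ?h u) u) = Re (inner_on A ?v u) + E" by simp
  moreover have "(cmod (inner_on A ?v u))\<^sup>2 \<le> (2 * \<eta>)\<^sup>2"
    using inner_on_Cauchy_Schwarz[of A ?v u] approx u1 by simp
  then have "cmod (inner_on A ?v u) \<le> 2 * \<eta>"
    by (rule power2_le_imp_le) (use \<eta> in simp)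
  moreover have "Re (inner_on A ?v u) \<le> cmod (inner_on A ?v u)" by (rule complex_Re_le_cmod)
  moreover have "Re (inner_on A (neg_laplacian u) u) \<le> Re (inner_on A (kernel_op A ?h u) u)"
    by (rule hamiltonian_form_ge[OF fin u0 \<omega>])
  \<comment> \<open>The left side is the energy of \<open>energy_bound_neg_laplacian\<close>. The
    threshold \<open>1 / (2 * C)\<close> lets the energy term of the Poincare inequality absorb only
    half of the unit mass.\<close>
  ultimately have "2 * Re (inner_on A (neg_laplacian u) u) \<le> 2 * E + 4 * \<eta>" by linarith
  then have "energy_bound u (1 / (2 * C))"
    using energy_bound_neg_laplacian[OF fin u0] low unfolding energy_bound_def by (meson order_trans)
  from poinc[OF u0 this] have "1 \<le> C * sqnorm (A \<inter> D) u + 1 / 2"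
    using u1 C by (simp add: distrib_left)
  then show ?thesis using C by (simp add: field_simps)
qed

text \<open>Moving from \<open>E\<close> to E + i\<eta> adds exactly \<eta>^2 to the error
  4\<eta>^2, hence the 5. The Ward identity trades one factor \<eta> for the imaginary part, and
  multiplying by 2C gives the 10.\<close>

lemma near_spectrum_imp_green_large:
  fixes A :: "(int ^ 'd) set"
  assumes poinc: "\<And>u K. (\<And>n. n \<notin> A \<Longrightarrow> u n = 0) \<Longrightarrow> energy_bound u K \<Longrightarrow>
      sqnorm A u \<le> C * (sqnorm (A \<inter> D) u + K)"
    and C: "C > 0" and fin: "finite A" and ne: "A \<noteq> {}" and \<omega>: "\<And>n. n \<in> A \<inter> D \<Longrightarrow> 0 \<le> \<omega> n"
    and \<eta>: "\<eta> > 0" and low: "2 * E + 4 * \<eta> \<le> 1 / (2 * C)"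
    and near: "infdist (complex_of_real E) (op_spectrum A (kernel_op A (box_kernel D \<omega>))) \<le> \<eta>"
  shows "1 \<le> 10 * C * \<eta> * (\<Sum>p\<in>A \<inter> D. Im (green A (box_kernel D \<omega>) (Complex E \<eta>) p p))"
proof -
  let ?h = "box_kernel D \<omega>" and ?z = "Complex E \<eta>"
  note h = adjoint_box_kernel[of D \<omega>]
  obtain u where u1: "sqnorm A u = 1" and u0: "\<And>n. n \<notin> A \<Longrightarrow> u n = 0"
    and u: "sqnorm A (kernel_op A (shift_kernel ?h (complex_of_real E)) u) \<le> (2 * \<eta>)\<^sup>2"
    by (rule infdist_spectrum_approximate_eigenvector[OF fin ne h \<eta> near]) blast
  have "sqnorm A (kernel_op A (shift_kernel ?h ?z) u) =
      sqnorm A (kernel_op A (shift_kernel ?h (complex_of_real E)) u) + \<eta>\<^sup>2"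
    unfolding sqnorm_hermitian_shift[OF fin h] u1 by (simp add: cmod_power2)
  then have uz: "sqnorm A (kernel_op A (shift_kernel ?h ?z) u) \<le> 5 * \<eta>\<^sup>2"
    using u by (simp add: power_mult_distrib)
  have "1 / (2 * C) \<le> sqnorm (A \<inter> D) u"
    using \<eta> by (intro low_energy_mass_on_delone[OF poinc C fin \<omega> _ low u1 u0 u]) auto
  also have "\<dots> \<le> (\<Sum>p\<in>A \<inter> D. 5 * \<eta>\<^sup>2 * sqnorm A (green A ?h ?z p))"
    unfolding sqnorm_def[of "A \<inter> D"]
  proof (rule sum_mono)
    fix p assume p: "p \<in> A \<inter> D"
    have "(cmod (u p))\<^sup>2 \<le> sqnorm A (kernel_op A (shift_kernel ?h ?z) u) * sqnorm A (green A ?h ?z p)"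
      using p \<eta> by (intro value_le_green[OF fin h]) auto
    also have "\<dots> \<le> 5 * \<eta>\<^sup>2 * sqnorm A (green A ?h ?z p)"
      using uz by (intro mult_right_mono) auto
    finally show "(cmod (u p))\<^sup>2 \<le> 5 * \<eta>\<^sup>2 * sqnorm A (green A ?h ?z p)" .
  qed
  also have "\<dots> = (\<Sum>p\<in>A \<inter> D. 5 * \<eta> * Im (green A ?h ?z p p))"
  proof (rule sum.cong[OF refl])
    fix p assume "p \<in> A \<inter> D"
    then show "5 * \<eta>\<^sup>2 * sqnorm A (green A ?h ?z p) = 5 * \<eta> * Im (green A ?h ?z p p)"
      using Im_green[OF fin h, of ?z p] \<eta> by (simp add: power2_eq_square)
  qed
  finally show ?thesis
    using C by (simp add: sum_distrib_left[symmetric] field_simps)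
qed

text \<open>Testing \<open>value_le_green\<close> with the unit vector at \<open>p\<close> shows
  that the column is not zero.\<close>

lemma Im_green_pos:
  assumes fin: "finite A" and h: "adjoint_kernel h = h" and z: "Im z > 0" and p: "p \<in> A"
  shows "Im (green A h z p p) > 0"
proof -
  have "1 \<le> sqnorm A (kernel_op A (shift_kernel h z) (site p)) * sqnorm A (green A h z p)"
    using value_le_green[OF fin h _ p, of z "site p"] z by (simp add: site_def)
  then have "sqnorm A (green A h z p) \<noteq> 0" by auto
  then show ?thesis
    using Im_green[OF fin h _ p, of z] z by (simp add: less_le)
qed

section \<open>Probabilistic part: averaging over the couplings\<close>

lemma emeasure_support_eq_1:
  assumes "prob_space \<mu>" and sets: "sets \<mu> = sets borel" and supp: "measure_support \<mu> \<subseteq> {a..b}"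
  shows "emeasure \<mu> {a..b} = 1"
proof -
  interpret prob_space \<mu> by fact
  define \<F> where "\<F> = {U :: real set. open U \<and> emeasure \<mu> U = 0}"
  \<comment> \<open>The complement of the support is a union of open null sets; by Lindelof
    countably many suffice, so the union is null.\<close>
  obtain \<F>' where F': "\<F>' \<subseteq> \<F>" "countable \<F>'" "\<Union>\<F>' = \<Union>\<F>"
    using Lindelof[of \<F>] by (auto simp: \<F>_def)
  have "(\<Union>U\<in>\<F>'. U) \<in> null_sets \<mu>"
    using F'(1,2) sets by (intro null_sets_UN') (auto simp: \<F>_def null_sets_def)
  then have null: "\<Union>\<F> \<in> null_sets \<mu>" using F'(3) by simp
  have "- {a..b} \<subseteq> \<Union>\<F>"
  proof
    fix t assume "t \<in> - {a..b}"
    then have "t \<notin> measure_support \<mu>" using supp by blast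
    then obtain U where "open U" "t \<in> U" "emeasure \<mu> U = 0"
      by (auto simp: measure_support_def zero_less_iff_neq_zero)
    then show "t \<in> \<Union>\<F>" by (auto simp: \<F>_def)
  qed
  then have "AE t in \<mu>. t \<in> {a..b}"
    by (intro AE_I'[OF null]) auto
  moreover have "{a..b} \<in> sets \<mu>" using sets by simp
  ultimately show ?thesis using emeasure_eq_1_AE by blast
qed

text \<open>Spectral averaging: with all couplings but the one at \<open>p\<close> frozen,
  \<open>G\<close> is a Cauchy density in that coupling, so its integral is at most the density
  bound times pi.\<close>

lemma nn_integral_green_le:
  fixes A :: "(int ^ 'd) set" and f :: "real \<Rightarrow> real"
  assumes \<mu>: "\<mu> = density lborel (\<lambda>t. ennreal (f t))" and f [measurable]: "f \<in> borel_measurable lborel"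
    and fC: "\<And>t. 0 \<le> f t \<and> f t \<le> c" and M: "M > 0"
    and prob: "prob_space (restrict_space \<mu> {0..M})"
    and fin: "finite A" and p: "p \<in> A \<inter> D" and z: "Im z > 0"
  defines "G \<equiv> (\<lambda>\<omega>. Im (green A (box_kernel D \<omega>) z p p))"
  shows "G \<in> borel_measurable (coupling_space M \<mu> D)"
    and "(\<integral>\<^sup>+\<omega>. ennreal (G \<omega>) \<partial>coupling_space M \<mu> D) \<le> ennreal (c * pi)"
proof -
  let ?\<nu> = "restrict_space \<mu> {0..M}"
  let ?D = "D - {p}"
  let ?N = "coupling_space M \<mu> D" and ?N' = "\<Pi>\<^sub>M n\<in>?D. ?\<nu>"
  have sets\<mu>: "sets \<mu> = sets borel" by (simp add: \<mu>)
  interpret \<nu>: prob_space ?\<nu> by fact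
  interpret N': prob_space ?N' by (intro prob_space_PiM prob)
  interpret pair: pair_sigma_finite ?\<nu> ?N' ..
  have id: "(\<lambda>v. v) \<in> borel_measurable ?\<nu>"
    by (intro measurable_restrict_space1) (simp add: measurable_def sets\<mu> \<mu>)
  have comp: "(\<lambda>\<omega>. \<omega> n) \<in> borel_measurable ?N" if "n \<in> D" for n
    using measurable_compose[OF measurable_component_singleton[OF that] id] unfolding coupling_space_def by simp
  have pot: "(\<lambda>\<omega>. potential D \<omega> n) \<in> borel_measurable ?N" for n
    using comp by (cases "n \<in> D") (simp_all add: potential_def)
  have ker: "(\<lambda>\<omega>. shift_kernel (box_kernel D \<omega>) z n m) \<in> borel_measurable ?N" for n m
    unfolding shift_kernel_def box_kernel_def using pot[of n] by (cases "n = m") simp_all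
  have green: "(\<lambda>\<omega>. green A (box_kernel D \<omega>) z p p) \<in> borel_measurable ?N"
    unfolding green_def
  proof (rule measurable_kernel_solve[OF ker fin])
    fix \<omega>
    show "\<exists>c>0. \<forall>u. c * sqnorm A u \<le> sqnorm A (kernel_op A (shift_kernel (box_kernel D \<omega>) z) u)"
      using z sqnorm_hermitian_shift_ge[OF fin adjoint_box_kernel] by (intro exI[of _ "(Im z)\<^sup>2"]) auto
  qed
  show G: "G \<in> borel_measurable ?N"
    unfolding G_def using green by (rule measurable_compose) simp
  have D: "insert p ?D = D" using p by auto
  \<comment> \<open>The coupling at \<open>p\<close> is split off as an independent factor, in
    preparation for Tonelli; \<open>D\<close> may be infinite.\<close>
  have N: "distr (?\<nu> \<Otimes>\<^sub>M ?N') ?N (\<lambda>(v, X). X(p := v)) = ?N"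
    using distr_pair_PiM_eq_PiM[of ?D "\<lambda>_. ?\<nu>" p] prob unfolding D coupling_space_def by simp
  have upd: "(\<lambda>(v, X). X(p := v)) \<in> measurable (?\<nu> \<Otimes>\<^sub>M ?N') ?N"
    using measurable_compose[OF measurable_pair_swap' measurable_add_dim[of p ?D "\<lambda>_. ?\<nu>"]]
    unfolding D coupling_space_def by (simp add: case_prod_beta')
  have Gupd: "(\<lambda>(v, X). ennreal (G (X(p := v)))) \<in> borel_measurable (?\<nu> \<Otimes>\<^sub>M ?N')"
    using measurable_compose[OF upd measurable_compose[OF G measurable_ennreal]] by (simp add: case_prod_beta')
  have "(\<integral>\<^sup>+\<omega>. ennreal (G \<omega>) \<partial>?N) = (\<integral>\<^sup>+\<omega>. ennreal (G \<omega>) \<partial>distr (?\<nu> \<Otimes>\<^sub>M ?N') ?N (\<lambda>(v, X). X(p := v)))"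
    by (simp only: N)
  also have "\<dots> = (\<integral>\<^sup>+(v, X). ennreal (G (X(p := v))) \<partial>(?\<nu> \<Otimes>\<^sub>M ?N'))"
    using G by (subst nn_integral_distr[OF upd]) (auto simp: case_prod_beta')
  also have "\<dots> = (\<integral>\<^sup>+X. (\<integral>\<^sup>+v. ennreal (G (X(p := v))) \<partial>?\<nu>) \<partial>?N')"
    using pair.nn_integral_snd[OF Gupd] by simp
  also have "\<dots> \<le> (\<integral>\<^sup>+X. ennreal (c * pi) \<partial>?N')"
  proof (rule nn_integral_mono)
    fix X
    \<comment> \<open>Setting the coupling at \<open>p\<close> to 0 gives a reference kernel that
      does not involve \<open>v\<close>.\<close>
    define h where "h = box_kernel D (X(p := 0))"
    define g where "g = green A h z p p"
    have hh: "adjoint_kernel h = h" by (simp add: h_def adjoint_box_kernel)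
    have g: "Im g > 0" unfolding g_def using p by (intro Im_green_pos[OF fin hh z]) auto
    have Gv: "G (X(p := v)) = Im (g / (1 + complex_of_real v * g))" for v
    proof -
      have "green A (box_kernel D (X(p := v))) z p p * (1 + complex_of_real v * g) = g"
        unfolding g_def
      proof (rule green_rank_one[OF fin hh])
        show "box_kernel D (X(p := v)) n m = h n m + (if n = p \<and> m = p then complex_of_real v else 0)" for n m
          using p by (auto simp: h_def box_kernel_def potential_def)
      qed (use z p in auto)
      \<comment> \<open>A zero denominator would force g = 0, against Im g > 0.\<close>
      moreover from this have "1 + complex_of_real v * g \<noteq> 0" using g by auto
      ultimately have "green A (box_kernel D (X(p := v))) z p p = g / (1 + complex_of_real v * g)"
        by (metis nonzero_eq_divide_eq)
      then show ?thesis by (simp only: G_def)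
    qed
    have meas [measurable]: "(\<lambda>v. ennreal (Im (g / (1 + complex_of_real v * g))) * indicator {0..M} v) \<in> borel_measurable borel"
      by measurable
    have "(\<integral>\<^sup>+v. ennreal (G (X(p := v))) \<partial>?\<nu>) = (\<integral>\<^sup>+v. ennreal (Im (g / (1 + complex_of_real v * g))) * indicator {0..M} v \<partial>\<mu>)"
      unfolding Gv by (subst nn_integral_restrict_space) (simp_all add: sets\<mu>)
    also have "\<dots> = (\<integral>\<^sup>+v. ennreal (f v) * (ennreal (Im (g / (1 + complex_of_real v * g))) * indicator {0..M} v) \<partial>lborel)"
      unfolding \<mu> by (rule nn_integral_density) auto
    also have "\<dots> \<le> (\<integral>\<^sup>+v. ennreal c * (ennreal (Im (g / (1 + complex_of_real v * g))) * indicator {0..M} v) \<partial>lborel)"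
      using fC by (intro nn_integral_mono mult_right_mono ennreal_leI) auto
    also have "\<dots> = ennreal c * (\<integral>\<^sup>+v. ennreal (Im (g / (1 + complex_of_real v * g))) * indicator {0..M} v \<partial>lborel)"
      by (rule nn_integral_cmult) simp
    also have "\<dots> \<le> ennreal c * ennreal pi"
      using M by (intro mult_left_mono nn_integral_Im_rank_one_le[OF g]) auto
    also have "\<dots> = ennreal (c * pi)"
      using fC[of 0] by (simp add: ennreal_mult)
    finally show "(\<integral>\<^sup>+v. ennreal (G (X(p := v))) \<partial>?\<nu>) \<le> ennreal (c * pi)" .
  qed
  also have "\<dots> = ennreal (c * pi)" by (simp add: N'.emeasure_space_1)
  finally show "(\<integral>\<^sup>+\<omega>. ennreal (G \<omega>) \<partial>?N) \<le> ennreal (c * pi)" .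
qed

text \<open>Markov's inequality: on the event a multiple of the sum of Im g is at least 1, so the
  indicator is dominated by that multiple, and each site of the box contributes at most c*pi to the
  expectation.\<close>

lemma measure_near_spectrum_le:
  fixes A :: "(int ^ 'd) set" and f :: "real \<Rightarrow> real"
  assumes \<mu>: "\<mu> = density lborel (\<lambda>t. ennreal (f t))" and f: "f \<in> borel_measurable lborel"
    and fC: "\<And>t. 0 \<le> f t \<and> f t \<le> c" and M: "M > 0"
    and prob: "prob_space (restrict_space \<mu> {0..M})"
    and fin: "finite A" and ne: "A \<noteq> {}" and C: "C > 0"
    and poinc: "\<And>u K. (\<And>n. n \<notin> A \<Longrightarrow> u n = 0) \<Longrightarrow> energy_bound u K \<Longrightarrow>
      sqnorm A u \<le> C * (sqnorm (A \<inter> D) u + K)"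
    and \<eta>: "\<eta> > 0" and low: "2 * E + 4 * \<eta> \<le> 1 / (2 * C)"
  shows "measure (coupling_space M \<mu> D) {\<omega> \<in> space (coupling_space M \<mu> D).
      infdist (complex_of_real E) (op_spectrum A (kernel_op A (box_kernel D \<omega>))) \<le> \<eta>}
    \<le> 10 * C * \<eta> * (real (card A) * (c * pi))"
    (is "measure ?N ?S \<le> ?B")
proof (cases "?S \<in> sets ?N")
  case False \<comment> \<open>the event need not be shown measurable: \<open>measure\<close> is 0 off the sigma-algebra\<close>
  then show ?thesis
    using C \<eta> fC[of 0] by (simp add: measure_notin_sets)
next
  case True
  define G where "G p \<omega> = Im (green A (box_kernel D \<omega>) (Complex E \<eta>) p p)" for p \<omega>
  have G [measurable]: "G p \<in> borel_measurable ?N"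
    and Gint: "(\<integral>\<^sup>+\<omega>. ennreal (G p \<omega>) \<partial>?N) \<le> ennreal (c * pi)" if "p \<in> A \<inter> D" for p
    unfolding G_def using nn_integral_green_le[OF \<mu> f fC M prob fin that, of "Complex E \<eta>"] \<eta> by simp_all
  have Gpos: "0 \<le> G p \<omega>" if "p \<in> A \<inter> D" for p \<omega>
    unfolding G_def using Im_green_pos[OF fin adjoint_box_kernel, of "Complex E \<eta>" p D \<omega>] \<eta> that by auto
  have "emeasure ?N ?S = (\<integral>\<^sup>+\<omega>. indicator ?S \<omega> \<partial>?N)"
    using True by simp
  also have "\<dots> \<le> (\<integral>\<^sup>+\<omega>. ennreal (10 * C * \<eta>) * (\<Sum>p\<in>A \<inter> D. ennreal (G p \<omega>)) \<partial>?N)"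
  proof (rule nn_integral_mono)
    fix \<omega> assume \<omega>: "\<omega> \<in> space ?N"
    show "indicator ?S \<omega> \<le> ennreal (10 * C * \<eta>) * (\<Sum>p\<in>A \<inter> D. ennreal (G p \<omega>))"
    proof (cases "\<omega> \<in> ?S")
      case True
      have "0 \<le> \<omega> n" if "n \<in> A \<inter> D" for n
        using \<omega> that by (auto simp: coupling_space_def space_PiM space_restrict_space dest: PiE_mem)
      then have "1 \<le> 10 * C * \<eta> * (\<Sum>p\<in>A \<inter> D. G p \<omega>)"
        unfolding G_def using True by (intro near_spectrum_imp_green_large[OF poinc C fin ne _ \<eta> low]) auto
      then have "ennreal 1 \<le> ennreal (10 * C * \<eta> * (\<Sum>p\<in>A \<inter> D. G p \<omega>))" by (rule ennreal_leI)
      also have "\<dots> = ennreal (10 * C * \<eta>) * (\<Sum>p\<in>A \<inter> D. ennreal (G p \<omega>))"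
      proof -
        have "(\<Sum>p\<in>A \<inter> D. ennreal (G p \<omega>)) = ennreal (\<Sum>p\<in>A \<inter> D. G p \<omega>)"
          using Gpos by (rule sum_ennreal)
        moreover have "0 \<le> (\<Sum>p\<in>A \<inter> D. G p \<omega>)" using Gpos by (rule sum_nonneg)
        ultimately show ?thesis using C \<eta> by (simp add: ennreal_mult)
      qed
      finally show ?thesis using True by simp
    qed simp
  qed
  also have "\<dots> = ennreal (10 * C * \<eta>) * (\<Sum>p\<in>A \<inter> D. \<integral>\<^sup>+\<omega>. ennreal (G p \<omega>) \<partial>?N)"
    using G by (subst nn_integral_cmult) (auto intro!: borel_measurable_sum simp: nn_integral_sum)
  also have "\<dots> \<le> ennreal (10 * C * \<eta>) * (\<Sum>p\<in>A \<inter> D. ennreal (c * pi))"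
    by (intro mult_left_mono sum_mono Gint) auto
  also have "\<dots> = ennreal (10 * C * \<eta> * (real (card (A \<inter> D)) * (c * pi)))"
    using C \<eta> fC[of 0] by (simp add: ennreal_mult ennreal_of_nat_eq_real_of_nat)
  also have "\<dots> \<le> ennreal ?B"
    using C \<eta> fC[of 0] fin by (intro ennreal_leI mult_left_mono mult_right_mono) (auto intro: card_mono)
  finally show ?thesis
    using C \<eta> fC[of 0] by (simp add: measure_def enn2real_leI)
qed

section \<open>Choice of constants and conclusion\<close>

theorem theorem2p1:
  fixes \<mu> :: "real measure" and R :: real
  assumes "R \<ge> 1"
    and "prob_space \<mu>"
    and "has_bounded_density \<mu>"
  shows "\<exists>Q\<^sub>W :: real \<Rightarrow> real \<Rightarrow> real.
    \<forall>(D :: (int ^ 'd) set) M. delone R D \<longrightarrow> M > 0 \<longrightarrow> measure_support \<mu> \<subseteq> {0..M} \<longrightarrow>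
      (\<exists>E\<^sub>W > 0. \<forall>a b. a \<le> b \<longrightarrow> {a..b} \<subseteq> {0..E\<^sub>W} \<longrightarrow>
        (\<forall>E \<in> {a..b}. \<forall>\<eta> \<in> {0<..1}. \<forall>L \<ge> 1. \<forall>x.
          measure (coupling_space M \<mu> D)
            {\<omega> \<in> space (coupling_space M \<mu> D).
              infdist (complex_of_real E) (op_spectrum (lattice_box L x) (box_hamiltonian D \<omega> x L)) \<le> \<eta>}
          \<le> Q\<^sub>W a b * \<eta> * real L ^ CARD('d)))"
proof -
  obtain f c where f: "f \<in> borel_measurable lborel" and fC: "\<And>t. 0 \<le> f t \<and> f t \<le> c"
    and \<mu>: "\<mu> = density lborel (\<lambda>t. ennreal (f t))"
    using assms(3) unfolding has_bounded_density_def by blast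
  have c: "c \<ge> 0" using fC[of 0] by linarith
  \<comment> \<open>\<open>C\<close> depends on \<open>R\<close> and the dimension only and is fixed
    before \<open>D\<close>; this makes the final constants uniform over all \<open>R\<close>-Delone
    sets.\<close>
  obtain C where C: "C > 0" and poinc: "\<And>(D :: (int ^ 'd) set) A u K. delone R D \<Longrightarrow> finite A \<Longrightarrow>
      (\<And>n. n \<notin> A \<Longrightarrow> u n = 0) \<Longrightarrow> energy_bound u K \<Longrightarrow> sqnorm A u \<le> C * (sqnorm (A \<inter> D) u + K)"
    by (rule delone_poincare[where R = R]) blast
  define B where "B = 10 * C * (3 ^ CARD('d) * (c * pi))"
  \<comment> \<open>\<open>B\<close> serves \<eta> \<le> 1/(16C). For larger \<eta> the summand 16C
    alone makes the right-hand side at least 1.\<close>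
  define Q where "Q = 16 * C + B"
  have B: "B \<ge> 0" using C c by (simp add: B_def)
  have Q: "measure (coupling_space M \<mu> D)
      {\<omega> \<in> space (coupling_space M \<mu> D).
        infdist (complex_of_real E) (op_spectrum (lattice_box L x) (box_hamiltonian D \<omega> x L)) \<le> \<eta>}
      \<le> Q * \<eta> * real L ^ CARD('d)" (is "measure ?N ?S \<le> _")
    if D: "delone R D" and M: "M > 0" and supp: "measure_support \<mu> \<subseteq> {0..M}"
      and E: "E \<le> 1 / (8 * C)" and \<eta>: "\<eta> > 0" and L: "L \<ge> 1"
    for D :: "(int ^ 'd) set" and M E \<eta> L x
  proof -
    have sets\<mu>: "sets \<mu> = sets borel" by (simp add: \<mu>)
    have prob: "prob_space (restrict_space \<mu> {0..M})"
      using emeasure_support_eq_1[OF assms(2) sets\<mu> supp] by (intro prob_space_restrict_space) (simp_all add: sets\<mu>)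
    interpret N: prob_space ?N
      unfolding coupling_space_def by (intro prob_space_PiM prob)
    have L1: "1 \<le> real L ^ CARD('d)" using L by simp
    show ?thesis
    proof (cases "\<eta> \<le> 1 / (16 * C)")
      case True
      let ?A = "lattice_box L x"
      \<comment> \<open>The thresholds for \<open>E\<close> and \<eta> each use up half, namely
        1/(4C), of the allowed 1/(2C).\<close>
      have "2 * E + 4 * \<eta> \<le> 2 * (1 / (8 * C)) + 4 * (1 / (16 * C))"
        using E True by linarith
      also have "\<dots> = 1 / (2 * C)" using C by (simp add: field_simps)
      finally have low: "2 * E + 4 * \<eta> \<le> 1 / (2 * C)" .
      have "measure ?N ?S \<le> 10 * C * \<eta> * (real (card ?A) * (c * pi))"
        unfolding box_hamiltonian_eq
        using center_in_lattice_box[of x L]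
        by (intro measure_near_spectrum_le[OF \<mu> f fC M prob finite_lattice_box _ C poinc[OF D finite_lattice_box] \<eta> low]) auto
      also have "\<dots> \<le> 10 * C * \<eta> * ((3 ^ CARD('d) * real L ^ CARD('d)) * (c * pi))"
        using C c \<eta> card_lattice_box_le[OF L, of x] by (intro mult_left_mono mult_right_mono) auto
      also have "\<dots> = B * \<eta> * real L ^ CARD('d)"
        by (simp add: B_def algebra_simps)
      also have "\<dots> \<le> Q * \<eta> * real L ^ CARD('d)"
        using C \<eta> by (intro mult_right_mono) (auto simp: Q_def)
      finally show ?thesis .
    next
      case False
      have "measure ?N ?S \<le> 1" by (rule N.prob_le_1)
      also have "1 \<le> 16 * C * \<eta>" using False C by (simp add: field_simps)
      also have "\<dots> \<le> Q * \<eta>" using B \<eta> by (intro mult_right_mono) (auto simp: Q_def)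
      also have "\<dots> = Q * \<eta> * 1" by simp
      also have "\<dots> \<le> Q * \<eta> * real L ^ CARD('d)"
        using L1 B C \<eta> by (intro mult_left_mono) (auto simp: Q_def)
      finally show ?thesis .
    qed
  qed
  show ?thesis
  \<comment> \<open>A constant function of the end points works because the estimate is uniform on
    the whole of [0, 1/(8C)].\<close>
  proof (intro exI[of _ "\<lambda>_ _. Q"] allI impI)
    fix D :: "(int ^ 'd) set" and M
    assume "delone R D" "M > 0" "measure_support \<mu> \<subseteq> {0..M}"
    then show "\<exists>E\<^sub>W > 0. \<forall>a b. a \<le> b \<longrightarrow> {a..b} \<subseteq> {0..E\<^sub>W} \<longrightarrow>
        (\<forall>E \<in> {a..b}. \<forall>\<eta> \<in> {0<..1}. \<forall>L \<ge> 1. \<forall>x.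
          measure (coupling_space M \<mu> D)
            {\<omega> \<in> space (coupling_space M \<mu> D).
              infdist (complex_of_real E) (op_spectrum (lattice_box L x) (box_hamiltonian D \<omega> x L)) \<le> \<eta>}
          \<le> Q * \<eta> * real L ^ CARD('d))"
      using Q C by (intro exI[of _ "1 / (8 * C)"] conjI allI impI ballI) (auto simp: subset_iff)
  qed
qed

end
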